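(* Let $l\ge1$ and $k$ be integers with $k>l+1$ and let $t\mapsto h(t)$ ($t\in\mathbb R$) be a continuous $\mathcal H_l$-valued function. The system $$y(t)=\int_{\mathbb R}h(s)\lozenge u(t-s)\,ds,\qquad t\in\mathbb R,$$ is $\mathbf L_2$-$\mathbf L_\infty$ stable if and only if $$\sup_{\substack{g\in\mathcal H_k\\ \|g\|_k\le1}}\int_{\mathbb R}\|T_{h(t)}^*g\|_k^2\,dt<\infty .$$
   Context: $\mathbb N=\{1,2,\ldots\}$. $\ell$ denotes the set of sequences $\alpha=(\alpha_1,\alpha_2,\ldots)$ of nonnegative integers indexed by $\mathbb N$ with $\alpha_j=0$ for all large $j$; $(2\mathbb N)^{k\alpha}=\prod_j(2j)^{k\alpha_j}$. $(H_\alpha)_{\alpha\in\ell}$ is the orthogonal basis of Hermite functions of the (complexified) white noise space. For $k\in\mathbb N$, $\mathcal H_k$ is the Hilbert space of formal series $f=\sum_{\alpha\in\ell}c_\alpha H_\alpha$, $c_\alpha\in\mathbb C$, with $\|f\|_k=\left(\sum_\alpha|c_\alpha|^2(2\mathbb N)^{-k\alpha}\right)^{1/2}<\infty$. The Wick product $\lozenge$ is determined bilinearly by $H_\alpha\lozenge H_\beta=H_{\alpha+\beta}$ (convolution of coefficients). For $k>l+1$ and $h\in\mathcal H_l$, $T_h:u\mapsto h\lozenge u$ is a bounded operator on $\mathcal H_k$ (Våge's inequality), and $T_h^*$ is its adjoint in $\mathcal H_k$. The system is called $\mathbf L_2$-$\mathbf L_\infty$ stable if there exists an $M<\infty$ such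 that $$\sup_{t\in\mathbb R}\left\|\int_{\mathbb R}h(s)\lozenge u(t-s)\,ds\right\|_k\le M\left(\int_{\mathbb R}\|u(t)\|_k^2\,dt\right)^{1/2}$$ (in particular the integrals exist) for all norm-continuous $\mathcal H_k$-valued functions $u$ on $\mathbb R$ for which the right-hand side is finite. Integrals of continuous $\mathcal H_k$-valued functions over compact intervals are Riemann integrals, and an $\mathcal H_k$-valued integral over $\mathbb R$ is the norm limit of $\int_a^b$ as $a\to-\infty$, $b\to+\infty$, when it exists. *)

theory Defs
  imports "HOL-Analysis.Analysis" "HOL-Library.Poly_Mapping"
begin

text \<open>
  The multi-indices \<open>\<alpha> = (\<alpha>\<^sub>1, \<alpha>\<^sub>2, \<dots>)\<close>: finitely supported sequences. Positions are shifted by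
  one, that is, \<open>lookup \<alpha> j\<close> is the entry with index \<open>j + 1\<close>.
\<close>

type_synonym multi_index = "nat \<Rightarrow>\<^sub>0 nat"

text \<open>\<open>weight k \<alpha> = (2\<nat>)\<^bsup>k\<alpha>\<^esup>\<close>; because of the shift the base at position \<open>j\<close> is \<open>2 (j + 1)\<close>.\<close>

definition weight :: "nat \<Rightarrow> multi_index \<Rightarrow> real" where
  "weight k \<alpha> =
    (\<Prod>j\<in>Poly_Mapping.keys \<alpha>. (2 * real (j + 1)) ^ (k * Poly_Mapping.lookup \<alpha> j))"

lemma weight_pos [simp]: "weight k \<alpha> > 0"
  unfolding weight_def by (intro prod_pos) auto

lemma weight_nonneg [simp]: "weight k \<alpha> \<ge> 0"
  using weight_pos[of k \<alpha>] by linarith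

lemma weight_neq_0 [simp]: "weight k \<alpha> \<noteq> 0"
  using weight_pos[of k \<alpha>] by linarith


section \<open>The Hilbert spaces of formal Hermite series\<close>

text \<open>
  \<open>'k kondratiev\<close> is the space \<open>\<H>\<^sub>k\<close> for \<open>k = CARD('k)\<close>; every integer \<open>k \<ge> 1\<close> is the cardinality of
  a finite type. The formal series \<open>\<Sum>\<^sub>\<alpha> c\<^sub>\<alpha> H\<^sub>\<alpha>\<close> is represented by its family of coefficients
  \<open>c\<close>, so that \<open>H\<^sub>\<alpha>\<close> is the family which is 1 at \<open>\<alpha>\<close> and 0 elsewhere.
\<close>

typedef (overloaded) 'k kondratiev =
  "{c :: multi_index \<Rightarrow> complex. (\<lambda>\<alpha>. (cmod (c \<alpha>))\<^sup>2 / weight CARD('k) \<alpha>) summable_on UNIV}"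
  morphisms coeff Series
  by (rule exI[of _ "\<lambda>_. 0"]) simp

lemma coeff_summable:
  "(\<lambda>\<alpha>. (cmod (coeff f \<alpha>))\<^sup>2 / weight CARD('k) \<alpha>) summable_on UNIV"
  for f :: "'k kondratiev"
  using coeff[of f] by simp

lemma kondratiev_eqI: "(\<And>\<alpha>. coeff f \<alpha> = coeff g \<alpha>) \<Longrightarrow> f = g"
  by (simp add: coeff_inject[symmetric] fun_eq_iff)

lemma weighted_summable_add:
  fixes c d :: "multi_index \<Rightarrow> complex"
  assumes "(\<lambda>\<alpha>. (cmod (c \<alpha>))\<^sup>2 / weight k \<alpha>) summable_on UNIV"
    and "(\<lambda>\<alpha>. (cmod (d \<alpha>))\<^sup>2 / weight k \<alpha>) summable_on UNIV"
  shows "(\<lambda>\<alpha>. (cmod (c \<alpha> + d \<alpha>))\<^sup>2 / weight k \<alpha>) summable_on UNIV"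
proof (rule summable_on_comparison_test)
  show "(\<lambda>\<alpha>. 2 * ((cmod (c \<alpha>))\<^sup>2 / weight k \<alpha>) + 2 * ((cmod (d \<alpha>))\<^sup>2 / weight k \<alpha>))
      summable_on UNIV"
    by (intro summable_on_add summable_on_cmult_right assms)
  fix \<alpha>
  have "(cmod (c \<alpha> + d \<alpha>))\<^sup>2 \<le> (cmod (c \<alpha>) + cmod (d \<alpha>))\<^sup>2"
    by (intro power_mono norm_triangle_ineq) simp
  also have "\<dots> \<le> 2 * (cmod (c \<alpha>))\<^sup>2 + 2 * (cmod (d \<alpha>))\<^sup>2"
    using sum_squares_bound[of "cmod (c \<alpha>)" "cmod (d \<alpha>)"] by (simp add: power2_sum)
  finally show "(cmod (c \<alpha> + d \<alpha>))\<^sup>2 / weight k \<alpha>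
      \<le> 2 * ((cmod (c \<alpha>))\<^sup>2 / weight k \<alpha>) + 2 * ((cmod (d \<alpha>))\<^sup>2 / weight k \<alpha>)"
    by (simp add: divide_right_mono flip: add_divide_distrib)
qed (simp_all add: zero_le_divide_iff)

lemma weighted_summable_scale:
  fixes c :: "multi_index \<Rightarrow> complex"
  assumes "(\<lambda>\<alpha>. (cmod (c \<alpha>))\<^sup>2 / weight k \<alpha>) summable_on UNIV"
  shows "(\<lambda>\<alpha>. (cmod (a * c \<alpha>))\<^sup>2 / weight k \<alpha>) summable_on UNIV"
  using summable_on_cmult_right[OF assms, of "(cmod a)\<^sup>2"]
  by (simp add: norm_mult power_mult_distrib)

instantiation kondratiev :: (finite) real_vector
begin

definition zero_kondratiev :: "'a kondratiev" where
  "0 = Series (\<lambda>_. 0)"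

definition plus_kondratiev :: "'a kondratiev \<Rightarrow> 'a kondratiev \<Rightarrow> 'a kondratiev" where
  "f + g = Series (\<lambda>\<alpha>. coeff f \<alpha> + coeff g \<alpha>)"

definition scaleR_kondratiev :: "real \<Rightarrow> 'a kondratiev \<Rightarrow> 'a kondratiev" where
  "r *\<^sub>R f = Series (\<lambda>\<alpha>. complex_of_real r * coeff f \<alpha>)"

definition uminus_kondratiev :: "'a kondratiev \<Rightarrow> 'a kondratiev" where
  "- f = (-1) *\<^sub>R f" for f :: "'a kondratiev"

definition minus_kondratiev :: "'a kondratiev \<Rightarrow> 'a kondratiev \<Rightarrow> 'a kondratiev" where
  "f - g = f + - g" for f g :: "'a kondratiev"

lemma coeff_zero: "coeff (0 :: 'a kondratiev) \<alpha> = 0"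
  unfolding zero_kondratiev_def by (subst Series_inverse) auto

lemma coeff_plus: "coeff (f + g) \<alpha> = coeff f \<alpha> + coeff g \<alpha>" for f g :: "'a kondratiev"
  unfolding plus_kondratiev_def
  by (subst Series_inverse) (auto intro: weighted_summable_add coeff_summable)

lemma coeff_scaleR: "coeff (r *\<^sub>R f) \<alpha> = complex_of_real r * coeff f \<alpha>" for f :: "'a kondratiev"
  unfolding scaleR_kondratiev_def
  by (subst Series_inverse) (auto intro: weighted_summable_scale coeff_summable)

lemma coeff_uminus: "coeff (- f) \<alpha> = - coeff f \<alpha>" for f :: "'a kondratiev"
  by (simp add: uminus_kondratiev_def coeff_scaleR)

lemma coeff_minus: "coeff (f - g) \<alpha> = coeff f \<alpha> - coeff g \<alpha>" for f g :: "'a kondratiev"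
  by (simp add: minus_kondratiev_def coeff_plus coeff_uminus)

instance
  by standard
    (auto intro!: kondratiev_eqI
      simp: coeff_zero coeff_plus coeff_scaleR coeff_uminus coeff_minus algebra_simps)

end

lemmas coeff_simps [simp] = coeff_zero coeff_plus coeff_scaleR coeff_uminus coeff_minus

text \<open>The complex inner product of \<open>\<H>\<^sub>k\<close>, conjugate linear in the second argument.\<close>

definition cinner :: "'k::finite kondratiev \<Rightarrow> 'k kondratiev \<Rightarrow> complex" where
  "cinner f g =
    (\<Sum>\<^sub>\<infinity>\<alpha>. coeff f \<alpha> * cnj (coeff g \<alpha>) / complex_of_real (weight CARD('k) \<alpha>))"

lemma cinner_abs_summable:
  fixes f g :: "'k::finite kondratiev"
  shows "(\<lambda>\<alpha>. norm (coeff f \<alpha> * cnj (coeff g \<alpha>) / complex_of_real (weight CARD('k) \<alpha>)))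
    summable_on UNIV"
proof (rule summable_on_comparison_test)
  show "(\<lambda>\<alpha>. (cmod (coeff f \<alpha>))\<^sup>2 / weight CARD('k) \<alpha>
      + (cmod (coeff g \<alpha>))\<^sup>2 / weight CARD('k) \<alpha>) summable_on UNIV"
    by (intro summable_on_add coeff_summable)
  fix \<alpha>
  have "cmod (coeff f \<alpha>) * cmod (coeff g \<alpha>) \<le> (cmod (coeff f \<alpha>))\<^sup>2 + (cmod (coeff g \<alpha>))\<^sup>2"
    using sum_squares_bound[of "cmod (coeff f \<alpha>)" "cmod (coeff g \<alpha>)"]
      mult_nonneg_nonneg[OF norm_ge_zero norm_ge_zero, of "coeff f \<alpha>" "coeff g \<alpha>"] by linarith
  then show "norm (coeff f \<alpha> * cnj (coeff g \<alpha>) / complex_of_real (weight CARD('k) \<alpha>))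
      \<le> (cmod (coeff f \<alpha>))\<^sup>2 / weight CARD('k) \<alpha> + (cmod (coeff g \<alpha>))\<^sup>2 / weight CARD('k) \<alpha>"
    by (simp add: norm_mult norm_divide divide_right_mono flip: add_divide_distrib)
qed simp

lemmas cinner_summable = abs_summable_summable[OF cinner_abs_summable]

lemma cinner_commute: "cinner g f = cnj (cinner f g)"
  by (simp add: cinner_def mult.commute flip: infsum_cnj)

lemma cinner_add_left: "cinner (f + g) h = cinner f h + cinner g h"
  unfolding cinner_def
  by (subst infsum_add[symmetric]) (auto intro: cinner_summable simp: field_simps)

lemma cinner_scaleR_left: "cinner (r *\<^sub>R f) g = complex_of_real r * cinner f g"
  unfolding cinner_def
  by (subst infsum_cmult_right[symmetric]) (auto intro: cinner_summable simp: mult.assoc)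

lemma cinner_self:
  "cinner f f = complex_of_real (\<Sum>\<^sub>\<infinity>\<alpha>. (cmod (coeff f \<alpha>))\<^sup>2 / weight CARD('k) \<alpha>)"
  for f :: "'k::finite kondratiev"
proof -
  have "((\<lambda>\<alpha>. complex_of_real ((cmod (coeff f \<alpha>))\<^sup>2 / weight CARD('k) \<alpha>))
      has_sum complex_of_real (\<Sum>\<^sub>\<infinity>\<alpha>. (cmod (coeff f \<alpha>))\<^sup>2 / weight CARD('k) \<alpha>)) UNIV"
    unfolding has_sum_of_real_iff using coeff_summable by (rule has_sum_infsum)
  then show ?thesis
    unfolding cinner_def by (intro infsumI) (simp flip: complex_norm_square)
qed

instantiation kondratiev :: (finite) real_inner
begin

definition inner_kondratiev :: "'a kondratiev \<Rightarrow> 'a kondratiev \<Rightarrow> real" where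
  "inner f g = Re (cinner f g)" for f g :: "'a kondratiev"

definition norm_kondratiev :: "'a kondratiev \<Rightarrow> real" where
  "norm f = sqrt (\<Sum>\<^sub>\<infinity>\<alpha>. (cmod (coeff f \<alpha>))\<^sup>2 / weight CARD('a) \<alpha>)"
    for f :: "'a kondratiev"

definition sgn_kondratiev :: "'a kondratiev \<Rightarrow> 'a kondratiev" where
  "sgn f = f /\<^sub>R norm f" for f :: "'a kondratiev"

definition dist_kondratiev :: "'a kondratiev \<Rightarrow> 'a kondratiev \<Rightarrow> real" where
  "dist f g = norm (f - g)" for f g :: "'a kondratiev"

definition uniformity_kondratiev :: "('a kondratiev \<times> 'a kondratiev) filter" where
  "(uniformity :: ('a kondratiev \<times> 'a kondratiev) filter)
    = (INF e\<in>{0<..}. principal {(f, g). dist f g < e})"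

definition open_kondratiev :: "'a kondratiev set \<Rightarrow> bool" where
  "open U \<longleftrightarrow> (\<forall>x\<in>U. eventually (\<lambda>(x', y). x' = x \<longrightarrow> y \<in> U) uniformity)"
    for U :: "'a kondratiev set"

instance
proof
  fix f g h :: "'a kondratiev" and r :: real and U :: "'a kondratiev set"
  show "sgn f = f /\<^sub>R norm f" by (rule sgn_kondratiev_def)
  show "dist f g = norm (f - g)" by (rule dist_kondratiev_def)
  show "(uniformity :: ('a kondratiev \<times> 'a kondratiev) filter)
      = (INF e\<in>{0<..}. principal {(f, g). dist f g < e})"
    by (rule uniformity_kondratiev_def)
  show "open U \<longleftrightarrow> (\<forall>x\<in>U. \<forall>\<^sub>F (x', y) in uniformity. x' = x \<longrightarrow> y \<in> U)"
    by (rule open_kondratiev_def)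
  show "inner f g = inner g f"
    by (simp add: inner_kondratiev_def cinner_commute[of f g])
  show "inner (f + g) h = inner f h + inner g h"
    by (simp add: inner_kondratiev_def cinner_add_left)
  show "inner (r *\<^sub>R f) g = r * inner f g"
    by (simp add: inner_kondratiev_def cinner_scaleR_left)
  show "0 \<le> inner f f"
    by (simp add: inner_kondratiev_def cinner_self infsum_nonneg)
  show "norm f = sqrt (inner f f)"
    by (simp add: inner_kondratiev_def cinner_self norm_kondratiev_def)
  show "inner f f = 0 \<longleftrightarrow> f = 0"
  proof
    assume "inner f f = 0"
    then have "(\<Sum>\<^sub>\<infinity>\<alpha>. (cmod (coeff f \<alpha>))\<^sup>2 / weight CARD('a) \<alpha>) \<le> 0"
      by (simp add: inner_kondratiev_def cinner_self)
    then have "(cmod (coeff f \<alpha>))\<^sup>2 / weight CARD('a) \<alpha> = 0" for \<alpha>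
      by (rule nonneg_infsum_le_0D) (auto intro: coeff_summable)
    then show "f = 0"
      by (intro kondratiev_eqI) simp
  next
    assume "f = 0"
    then show "inner f f = 0"
      by (simp add: inner_kondratiev_def cinner_self)
  qed
qed

end

lemma norm_kondratiev_power2:
  "(norm f)\<^sup>2 = (\<Sum>\<^sub>\<infinity>\<alpha>. (cmod (coeff f \<alpha>))\<^sup>2 / weight CARD('k) \<alpha>)"
  for f :: "'k::finite kondratiev"
  by (simp add: norm_kondratiev_def infsum_nonneg)

lemma sum_coeff_le_norm:
  fixes f :: "'k::finite kondratiev"
  assumes "finite F"
  shows "(\<Sum>\<alpha>\<in>F. (cmod (coeff f \<alpha>))\<^sup>2 / weight CARD('k) \<alpha>) \<le> (norm f)\<^sup>2"
  unfolding norm_kondratiev_power2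
  by (rule finite_sum_le_infsum) (auto intro: coeff_summable assms)

instance kondratiev :: (finite) complete_space
proof
  fix X :: "nat \<Rightarrow> 'a kondratiev"
  let ?w = "weight CARD('a)"
  assume X: "Cauchy X"
  have "Cauchy (\<lambda>n. coeff (X n) \<alpha>)" for \<alpha>
  proof (rule metric_CauchyI)
    fix e :: real assume "e > 0"
    then have "e / sqrt (?w \<alpha>) > 0" by simp
    from metric_CauchyD[OF X this] obtain N
      where N: "\<And>m n. m \<ge> N \<Longrightarrow> n \<ge> N \<Longrightarrow> dist (X m) (X n) < e / sqrt (?w \<alpha>)" by blast
    have "dist (coeff (X m) \<alpha>) (coeff (X n) \<alpha>) < e" if "m \<ge> N" "n \<ge> N" for m n
    proof -
      have "(cmod (coeff (X m - X n) \<alpha>))\<^sup>2 / ?w \<alpha> \<le> (norm (X m - X n))\<^sup>2"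
        using sum_coeff_le_norm[of "{\<alpha>}" "X m - X n"] by simp
      also have "\<dots> < (e / sqrt (?w \<alpha>))\<^sup>2"
        using N[OF that] by (intro power_strict_mono) (auto simp: dist_norm)
      also have "\<dots> = e\<^sup>2 / ?w \<alpha>" by (simp add: power_divide)
      finally have "(cmod (coeff (X m - X n) \<alpha>))\<^sup>2 < e\<^sup>2"
        by (simp add: divide_less_cancel)
      then show ?thesis
        using \<open>e > 0\<close> by (simp add: dist_norm power_less_imp_less_base)
    qed
    then show "\<exists>N. \<forall>m\<ge>N. \<forall>n\<ge>N. dist (coeff (X m) \<alpha>) (coeff (X n) \<alpha>) < e" by blast
  qed
  then have "\<forall>\<alpha>. \<exists>c. (\<lambda>n. coeff (X n) \<alpha>) \<longlonglongrightarrow> c"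
    using Cauchy_convergent_iff convergent_def by metis
  then obtain c where c: "\<And>\<alpha>. (\<lambda>n. coeff (X n) \<alpha>) \<longlonglongrightarrow> c \<alpha>" by metis
  have bound: "(\<Sum>\<alpha>\<in>F. (cmod (coeff (X m) \<alpha> - c \<alpha>))\<^sup>2 / ?w \<alpha>) \<le> e\<^sup>2"
    if "finite F" and N: "\<And>n. n \<ge> N \<Longrightarrow> dist (X m) (X n) < e" for F m N and e :: real
  proof (rule tendsto_upperbound)
    show "(\<lambda>n. \<Sum>\<alpha>\<in>F. (cmod (coeff (X m) \<alpha> - coeff (X n) \<alpha>))\<^sup>2 / ?w \<alpha>)
        \<longlonglongrightarrow> (\<Sum>\<alpha>\<in>F. (cmod (coeff (X m) \<alpha> - c \<alpha>))\<^sup>2 / ?w \<alpha>)"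
      by (intro tendsto_intros c) simp
    show "\<forall>\<^sub>F n in sequentially.
        (\<Sum>\<alpha>\<in>F. (cmod (coeff (X m) \<alpha> - coeff (X n) \<alpha>))\<^sup>2 / ?w \<alpha>) \<le> e\<^sup>2"
    proof (rule eventually_sequentiallyI)
      fix n assume "n \<ge> N"
      have "(\<Sum>\<alpha>\<in>F. (cmod (coeff (X m - X n) \<alpha>))\<^sup>2 / ?w \<alpha>) \<le> (norm (X m - X n))\<^sup>2"
        by (rule sum_coeff_le_norm) fact
      also have "\<dots> \<le> e\<^sup>2"
        using N[OF \<open>n \<ge> N\<close>] by (intro power_mono) (auto simp: dist_norm)
      finally show "(\<Sum>\<alpha>\<in>F. (cmod (coeff (X m) \<alpha> - coeff (X n) \<alpha>))\<^sup>2 / ?w \<alpha>) \<le> e\<^sup>2"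
        by simp
    qed
  qed simp
  have summable: "(\<lambda>\<alpha>. (cmod (coeff (X m) \<alpha> - c \<alpha>))\<^sup>2 / ?w \<alpha>) summable_on UNIV"
    if "\<And>n. n \<ge> N \<Longrightarrow> dist (X m) (X n) < e" for m N and e :: real
    by (rule nonneg_bdd_above_summable_on)
      (use bound[OF _ that] in \<open>auto simp: bdd_above_def\<close>)
  obtain N where N: "\<And>m n. m \<ge> N \<Longrightarrow> n \<ge> N \<Longrightarrow> dist (X m) (X n) < 1"
    using metric_CauchyD[OF X, of 1] by auto
  have "(\<lambda>\<alpha>. (cmod (coeff (X N) \<alpha> + (-1) * (coeff (X N) \<alpha> - c \<alpha>)))\<^sup>2 / ?w \<alpha>) summable_on UNIV"
    by (intro weighted_summable_add weighted_summable_scale coeff_summable summable[of N N 1] N) auto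
  then have coeff_lim: "coeff (Series c :: 'a kondratiev) = c"
    by (intro Series_inverse) simp
  have "X \<longlonglongrightarrow> Series c"
  proof (rule metric_LIMSEQ_I)
    fix r :: real assume "r > 0"
    then obtain N where N: "\<And>m n. m \<ge> N \<Longrightarrow> n \<ge> N \<Longrightarrow> dist (X m) (X n) < r / 2"
      using metric_CauchyD[OF X, of "r / 2"] by auto
    have "dist (X m) (Series c) < r" if "m \<ge> N" for m
    proof -
      have "(\<Sum>\<^sub>\<infinity>\<alpha>. (cmod (coeff (X m) \<alpha> - c \<alpha>))\<^sup>2 / ?w \<alpha>) \<le> (r / 2)\<^sup>2"
        by (intro infsum_le_finite_sums summable[OF N] bound[OF _ N] that)
      then have "(norm (X m - Series c))\<^sup>2 \<le> (r / 2)\<^sup>2"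
        by (simp add: norm_kondratiev_power2 coeff_lim)
      then have "norm (X m - Series c) \<le> r / 2"
        by (rule power2_le_imp_le) (use \<open>r > 0\<close> in simp)
      then show ?thesis
        using \<open>r > 0\<close> by (simp add: dist_norm)
    qed
    then show "\<exists>N. \<forall>m\<ge>N. dist (X m) (Series c) < r" by blast
  qed
  then show "convergent X" by (rule convergentI)
qed

instance kondratiev :: (finite) banach ..


section \<open>The Wick product and its multiplication operators\<close>

lemma finite_decompositions: "finite {(\<alpha>, \<beta>). \<alpha> + \<beta> = (\<gamma> :: multi_index)}"
proof -
  let ?L = "Poly_Mapping.lookup"
  let ?E = "{f. \<forall>j. (j \<in> Poly_Mapping.keys \<gamma> \<longrightarrow> f j \<in> {..Max (insert 0 (range (?L \<gamma>)))})
    \<and> (j \<notin> Poly_Mapping.keys \<gamma> \<longrightarrow> f j = (0::nat))}"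
  have fin: "finite (range (?L \<gamma>))"
  proof (rule finite_subset)
    show "range (?L \<gamma>) \<subseteq> insert 0 (?L \<gamma> ` Poly_Mapping.keys \<gamma>)"
      by (auto simp: in_keys_iff)
  qed simp
  have "finite ?E" by (rule finite_set_of_finite_funs) auto
  moreover have "?L ` {\<alpha>. \<exists>\<beta>. \<alpha> + \<beta> = \<gamma>} \<subseteq> ?E"
  proof (rule image_subsetI)
    fix \<alpha> assume "\<alpha> \<in> {\<alpha>. \<exists>\<beta>. \<alpha> + \<beta> = \<gamma>}"
    then have le: "?L \<alpha> j \<le> ?L \<gamma> j" for j by (auto simp: lookup_add)
    have "?L \<gamma> j \<le> Max (insert 0 (range (?L \<gamma>)))" for j using fin by (intro Max_ge) auto
    then have "?L \<alpha> j \<le> Max (insert 0 (range (?L \<gamma>)))" for j using le[of j] order_trans by blast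
    moreover have "?L \<alpha> j = 0" if "j \<notin> Poly_Mapping.keys \<gamma>" for j
      using le[of j] that by (simp add: in_keys_iff)
    ultimately show "?L \<alpha> \<in> ?E" by blast
  qed
  ultimately have "finite (?L ` {\<alpha>. \<exists>\<beta>. \<alpha> + \<beta> = \<gamma>})" by (rule rev_finite_subset)
  moreover have "inj_on ?L A" for A :: "multi_index set"
    by (auto intro: inj_onI simp: lookup_inject)
  ultimately have *: "finite {\<alpha>. \<exists>\<beta>. \<alpha> + \<beta> = \<gamma>}" by (rule finite_imageD)
  show ?thesis
    by (rule finite_subset[OF _ finite_cartesian_product[OF * *]])
      (auto, metis add.commute)
qed

definition wick_conv ::
  "(multi_index \<Rightarrow> complex) \<Rightarrow> (multi_index \<Rightarrow> complex) \<Rightarrow> multi_index \<Rightarrow> complex" where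
  "wick_conv a b \<gamma> = (\<Sum>(\<alpha>, \<beta>)\<in>{(\<alpha>, \<beta>). \<alpha> + \<beta> = \<gamma>}. a \<alpha> * b \<beta>)"

text \<open>
  The Wick product \<open>h \<lozenge> u\<close> of \<open>h \<in> \<H>\<^sub>l\<close> and \<open>u \<in> \<H>\<^sub>k\<close>, as an element of \<open>\<H>\<^sub>k\<close>; \<open>wick h\<close> is the operator
  \<open>T\<^sub>h\<close> on \<open>\<H>\<^sub>k\<close>. It is only meant for \<open>k > l + 1\<close>: then the convolution of the coefficients is again in
  \<open>\<H>\<^sub>k\<close>, by the inequality of Vaage. For other \<open>k\<close> and \<open>l\<close> the value is unspecified where
  the convolution does not belong to \<open>\<H>\<^sub>k\<close>.
\<close>

definition wick ::
  "'l::finite kondratiev \<Rightarrow> 'k::finite kondratiev \<Rightarrow> 'k kondratiev"  (infixl "\<lozenge>" 70) where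
  "h \<lozenge> u = Series (wick_conv (coeff h) (coeff u))"

text \<open>
  The adjoint with respect to the complex inner product. The library's \<open>adjoint\<close> refers to the
  real one.
\<close>

definition hilbert_adjoint ::
  "('k::finite kondratiev \<Rightarrow> 'k kondratiev) \<Rightarrow> 'k kondratiev \<Rightarrow> 'k kondratiev" where
  "hilbert_adjoint T = (THE S. \<forall>f g. cinner (T f) g = cinner f (S g))"


section \<open>Stability\<close>

text \<open>
  Integrals over \<open>\<real>\<close> as norm limits of integrals over compact intervals. The integral of the library
  is the gauge version of the Riemann integral and equals the latter for continuous integrands.
\<close>

definition has_line_integral :: "(real \<Rightarrow> 'a::banach) \<Rightarrow> 'a \<Rightarrow> bool" where
  "has_line_integral f y \<longleftrightarrow>
    (\<forall>a b. f integrable_on {a..b}) \<and>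
    ((\<lambda>(a, b). integral {a..b} f) \<longlongrightarrow> y) (at_bot \<times>\<^sub>F at_top)"

text \<open>
  The stability of the system with impulse response \<open>h\<close> on \<open>\<H>\<^sub>k\<close>-valued inputs. The type argument
  only serves to supply \<open>k\<close>.
\<close>

definition L2_Linf_stable :: "'k::finite itself \<Rightarrow> (real \<Rightarrow> 'l::finite kondratiev) \<Rightarrow> bool" where
  "L2_Linf_stable _ h \<longleftrightarrow>
    (\<exists>M::real. \<forall>u :: real \<Rightarrow> 'k kondratiev.
      continuous_on UNIV u \<longrightarrow> integrable lborel (\<lambda>t. (norm (u t))\<^sup>2) \<longrightarrow>
      (\<exists>y. (\<forall>t. has_line_integral (\<lambda>s. h s \<lozenge> u (t - s)) (y t)) \<and>
        (SUP t. ereal (norm (y t))) \<le> ereal (M * sqrt (LINT t|lborel. (norm (u t))\<^sup>2))))"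

end

theory Submission
  imports Defs
begin

text \<open>
  The criterion is a duality statement. Testing the output against \<open>g \<in> \<H>\<^sub>k\<close> moves the impulse
  response to the other side,
  \<open>\<langle>\<integral> h(s) \<lozenge> v(s) ds, g\<rangle> = \<integral> \<langle>v(s), T\<^sub>h\<^sub>(\<^sub>s\<^sub>)\<^sup>* g\<rangle> ds\<close>, so that the map \<open>v \<mapsto> \<integral> h(s) \<lozenge> v(s) ds\<close> is the
  transpose of \<open>g \<mapsto> (s \<mapsto> T\<^sub>h\<^sub>(\<^sub>s\<^sub>)\<^sup>* g)\<close>, and the one is bounded \<open>L\<^sub>2 \<rightarrow> \<H>\<^sub>k\<close> exactly if the other is bounded
  \<open>\<H>\<^sub>k \<rightarrow> L\<^sub>2\<close>. The output at time \<open>t\<close> is this map applied to the reflected input \<open>v(s) = u(t - s)\<close>, which has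
  the same \<open>L\<^sub>2\<close> norm as \<open>u\<close>; hence a bound at one time is a bound at all times.

  If the energies \<open>\<integral> \<parallel>T\<^sub>h\<^sub>(\<^sub>s\<^sub>)\<^sup>* g\<parallel>\<^sup>2 ds\<close> are bounded by \<open>C\<^sup>2\<close> on the unit ball, the Cauchy-Schwarz inequality
  bounds the integral over every compact interval by \<open>C\<close> times the \<open>L\<^sub>2\<close> norm of \<open>v\<close> on that interval
  (\<open>norm_integral_le\<close>). The tails of \<open>\<integral> \<parallel>v\<parallel>\<^sup>2\<close> tend to zero, so the integrals over compact intervals
  form a Cauchy net, although \<open>h(s) \<lozenge> v(s)\<close> may fail to be absolutely integrable (\<open>bounded_output\<close>).
  Conversely, the input \<open>v(s) = T\<^sub>h\<^sub>(\<^sub>s\<^sub>)\<^sup>* g\<close>, cut off continuously outside a compact interval, produces an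
  output \<open>y\<close> with \<open>\<langle>y, g\<rangle>\<close> at least \<open>\<integral> \<parallel>v\<parallel>\<^sup>2\<close>. Stability with constant \<open>M\<close> thus gives
  \<open>\<integral> \<parallel>v\<parallel>\<^sup>2 \<le> M (\<integral> \<parallel>v\<parallel>\<^sup>2)\<^bsup>1/2\<^esup>\<close>, and \<open>M\<^sup>2\<close> bounds the energy on every compact interval (\<open>energy_le\<close>).

  This argument rests on two facts about the operators \<open>T\<^sub>h\<close> for a single \<open>h \<in> \<H>\<^sub>l\<close>. They are bounded,
  with norm at most a constant times \<open>\<parallel>h\<parallel>\<^sub>l\<close>; this is Vaage's inequality (\<open>norm_wick_le\<close>), which comes from the
  convergence of \<open>\<Sum>\<^sub>\<alpha> (2\<nat>)\<^bsup>-(k-l)\<alpha>\<^esup>\<close> for \<open>k - l \<ge> 2\<close>. And they have adjoints, by the Riesz representation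
  theorem, which on \<open>\<H>\<^sub>k\<close> can be read off from the coefficients. Both together make \<open>s \<mapsto> h(s) \<lozenge> v(s)\<close> and
  \<open>s \<mapsto> T\<^sub>h\<^sub>(\<^sub>s\<^sub>)\<^sup>* g\<close> continuous.
\<close>


section \<open>Weights\<close>

lemma weight_eq_prod_superset:
  assumes "finite A" "Poly_Mapping.keys \<alpha> \<subseteq> A"
  shows "weight k \<alpha> = (\<Prod>j\<in>A. (2 * real (j + 1)) ^ (k * Poly_Mapping.lookup \<alpha> j))"
  unfolding weight_def
  by (rule prod.mono_neutral_left) (use assms in \<open>auto simp: in_keys_iff\<close>)

lemma weight_add_index: "weight k (\<alpha> + \<beta>) = weight k \<alpha> * weight k \<beta>"
proof -
  let ?A = "Poly_Mapping.keys \<alpha> \<union> Poly_Mapping.keys \<beta>"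
  have "weight k \<gamma> = (\<Prod>j\<in>?A. (2 * real (j + 1)) ^ (k * Poly_Mapping.lookup \<gamma> j))"
    if "Poly_Mapping.keys \<gamma> \<subseteq> ?A" for \<gamma>
    using that by (intro weight_eq_prod_superset) auto
  from this[of \<alpha>] this[of \<beta>] this[of "\<alpha> + \<beta>"] show ?thesis
    using Poly_Mapping.keys_add[of \<alpha> \<beta>]
    by (simp add: lookup_add distrib_left power_add prod.distrib)
qed

lemma weight_add_exponent: "weight (k + n) \<alpha> = weight k \<alpha> * weight n \<alpha>"
  by (simp add: weight_def distrib_right power_add prod.distrib)

text \<open>
  The factors are the values of the geometric series with ratio \<open>(2j)\<^bsup>-2\<^esup>\<close>. The infinite product is Wallis'
  product \<open>\<pi> / 2\<close>; the right-hand side is chosen so that it starts at 1 and its successive quotients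
  \<open>1 + 1 / (2n\<^sup>2 + 5n + 2)\<close> dominate the factors \<open>1 + 1 / (4n\<^sup>2 + 8n + 3)\<close>.
\<close>

lemma wallis_partial_product_le:
  "(\<Prod>j<n. 1 / (1 - (1 / (2 * real (j + 1)))\<^sup>2)) \<le> 2 - 1 / real (n + 1)"
proof (induction n)
  case (Suc n)
  have pos: "0 \<le> 1 / (1 - (1 / (2 * real (n + 1)))\<^sup>2)"
    by (simp add: power_le_one)
  have "(\<Prod>j<Suc n. 1 / (1 - (1 / (2 * real (j + 1)))\<^sup>2))
      \<le> (2 - 1 / real (n + 1)) * (1 / (1 - (1 / (2 * real (n + 1)))\<^sup>2))"
    using mult_right_mono[OF Suc pos] by simp
  also have "\<dots> \<le> 2 - 1 / real (Suc n + 1)"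
  proof -
    define x where "x = real n"
    have x: "x \<ge> 0" by (simp add: x_def)
    have 1: "1 / (1 - (1 / (2 * (x + 1)))\<^sup>2) = 4 * (x + 1)\<^sup>2 / ((2 * x + 1) * (2 * x + 3))"
    proof -
      have "1 - (1 / (2 * (x + 1)))\<^sup>2 = ((2 * x + 1) * (2 * x + 3)) / (4 * (x + 1)\<^sup>2)"
        using x by (simp add: divide_simps power2_eq_square) (simp add: algebra_simps)
      then show ?thesis by simp
    qed
    have 2: "2 - 1 / (x + 1) = (2 * x + 1) / (x + 1)"
      using x by (simp add: divide_simps)
    have 3: "2 - 1 / (x + 2) = (2 * x + 3) / (x + 2)"
      using x by (simp add: divide_simps)
    have "(2 * x + 1) / (x + 1) * (4 * (x + 1)\<^sup>2 / ((2 * x + 1) * (2 * x + 3)))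
        = 4 * (x + 1) / (2 * x + 3)"
      using x by (simp add: divide_simps power2_eq_square) simp?
    also have "\<dots> \<le> (2 * x + 3) / (x + 2)"
      using x by (simp add: divide_simps) (simp add: algebra_simps)
    finally show ?thesis
      using 1 2 3 by (simp add: x_def add.commute)
  qed
  finally show ?case .
qed simp

text \<open>
  Expanding a finite product of geometric series over the positions \<open>j\<close> gives one summand
  \<open>(2\<nat>)\<^bsup>-n\<alpha>\<^esup>\<close> for each \<open>\<alpha>\<close> with bounded support and entries. For \<open>n \<ge> 2\<close> the product of all the full
  series converges; for \<open>n = 1\<close> it diverges, as \<open>\<Sum>\<^sub>j 1 / (2j)\<close> does.
\<close>

lemma sum_inverse_weight_le:
  assumes "n \<ge> 2" "finite F"
  shows "(\<Sum>\<alpha>\<in>F. 1 / weight n \<alpha>) \<le> 2"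
proof -
  let ?L = "Poly_Mapping.lookup :: multi_index \<Rightarrow> nat \<Rightarrow> nat"
  have fin: "finite (\<Union>\<alpha>\<in>F. Poly_Mapping.keys \<alpha>)" "finite (\<Union>\<alpha>\<in>F. ?L \<alpha> ` Poly_Mapping.keys \<alpha>)"
    using assms by auto
  obtain N where N: "(\<Union>\<alpha>\<in>F. Poly_Mapping.keys \<alpha>) \<subseteq> {..<N}"
    using finite_nat_iff_bounded fin(1) by blast
  obtain m where m: "(\<Union>\<alpha>\<in>F. ?L \<alpha> ` Poly_Mapping.keys \<alpha>) \<subseteq> {..<m}"
    using finite_nat_iff_bounded fin(2) by blast
  \<comment> \<open>\<open>F\<close> is embedded into the finite box of exponents below \<open>Suc m\<close> at the positions below \<open>N\<close>.\<close>
  define q where "q j = (1 / (2 * real (j + 1))) ^ n" for j :: nat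
  have q0: "0 \<le> q j" for j by (simp add: q_def)
  have q1: "q j \<le> (1 / (2 * real (j + 1)))\<^sup>2" for j
    unfolding q_def using assms by (intro power_decreasing) (auto simp: divide_simps)
  have q2: "(1 / (2 * real (j + 1)))\<^sup>2 < 1" for j
    by (intro power_less_one_iff[THEN iffD2]) (auto simp: divide_simps)
  let ?r = "\<lambda>\<alpha>. restrict (?L \<alpha>) {..<N}"
  have keysN: "Poly_Mapping.keys \<alpha> \<subseteq> {..<N}" if "\<alpha> \<in> F" for \<alpha>
    using N that by blast
  have lookm: "?L \<alpha> j < Suc m" if "\<alpha> \<in> F" for \<alpha> j
  proof (cases "j \<in> Poly_Mapping.keys \<alpha>")
    case True
    then have "?L \<alpha> j \<in> {..<m}" using m that by blast
    then show ?thesis by simp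
  next
    case False
    then show ?thesis by (simp add: in_keys_iff)
  qed
  have sub: "?r ` F \<subseteq> PiE {..<N} (\<lambda>_. {..<Suc m})"
    by (intro image_subsetI) (subst restrict_PiE_iff, use lookm in blast)
  have inj: "inj_on ?r F"
  proof (rule inj_onI)
    fix \<alpha> \<beta> assume ab: "\<alpha> \<in> F" "\<beta> \<in> F" "?r \<alpha> = ?r \<beta>"
    have "?L \<alpha> j = ?L \<beta> j" for j
    proof (cases "j < N")
      case True
      then show ?thesis using fun_cong[OF ab(3), of j] by simp
    next
      case False
      then have "j \<notin> Poly_Mapping.keys \<alpha>" "j \<notin> Poly_Mapping.keys \<beta>"
        using keysN ab by auto
      then show ?thesis by (simp add: in_keys_iff)
    qed
    then show "\<alpha> = \<beta>" by (simp add: poly_mapping_eq_iff fun_eq_iff)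
  qed
  have "(\<Sum>\<alpha>\<in>F. 1 / weight n \<alpha>) = (\<Sum>\<alpha>\<in>F. \<Prod>j<N. q j ^ ?r \<alpha> j)"
  proof (rule sum.cong)
    fix \<alpha> assume "\<alpha> \<in> F"
    then have "weight n \<alpha> = (\<Prod>j<N. (2 * real (j + 1)) ^ (n * ?L \<alpha> j))"
      using keysN by (intro weight_eq_prod_superset) auto
    then show "1 / weight n \<alpha> = (\<Prod>j<N. q j ^ ?r \<alpha> j)"
      by (simp add: q_def power_one_over power_mult prod_dividef)
  qed simp
  also have "\<dots> = (\<Sum>x\<in>?r ` F. \<Prod>j<N. q j ^ x j)"
    using inj by (simp add: sum.reindex)
  also have "\<dots> \<le> (\<Sum>x\<in>PiE {..<N} (\<lambda>_. {..<Suc m}). \<Prod>j<N. q j ^ x j)"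
    using sub by (intro sum_mono2) (auto intro!: finite_PiE prod_nonneg q0 zero_le_power)
  also have "\<dots> = (\<Prod>j<N. \<Sum>i<Suc m. q j ^ i)"
    by (rule prod_sum_PiE[symmetric]) auto
  also have "\<dots> \<le> (\<Prod>j<N. 1 / (1 - (1 / (2 * real (j + 1)))\<^sup>2))"
  proof (intro prod_mono conjI sum_nonneg)
    fix j
    have "q j < 1" using q1[of j] q2[of j] by linarith
    then have "(\<Sum>i<Suc m. q j ^ i) \<le> suminf (\<lambda>i. q j ^ i)"
      using q0[of j] by (intro sum_le_suminf summable_geometric) auto
    also have "\<dots> = 1 / (1 - q j)"
      using q0[of j] \<open>q j < 1\<close> by (intro suminf_geometric) auto
    also have "\<dots> \<le> 1 / (1 - (1 / (2 * real (j + 1)))\<^sup>2)"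
      using q1[of j] q2[of j] by (intro divide_left_mono mult_pos_pos) auto
    finally show "(\<Sum>i<Suc m. q j ^ i) \<le> 1 / (1 - (1 / (2 * real (j + 1)))\<^sup>2)" .
  qed (auto intro: zero_le_power q0)
  also have "\<dots> \<le> 2 - 1 / real (N + 1)"
    by (rule wallis_partial_product_le)
  also have "\<dots> \<le> 2" by simp
  finally show ?thesis .
qed


section \<open>Vaage's inequality\<close>

text \<open>
  For \<open>h \<in> \<H>\<^sub>l\<close> the family \<open>h\<^sub>\<alpha> (2\<nat>)\<^bsup>-k\<alpha>/2\<^esup>\<close> is even absolutely summable: split off the factor
  \<open>(2\<nat>)\<^bsup>-(k-l)\<alpha>/2\<^esup>\<close> and apply the Cauchy-Schwarz inequality.
\<close>

lemma sum_sqrt_weight_le: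
  fixes h :: "'l::finite kondratiev"
  assumes "k > CARD('l) + 1" "finite F"
  shows "(\<Sum>\<alpha>\<in>F. cmod (coeff h \<alpha>) / sqrt (weight k \<alpha>)) \<le> sqrt 2 * norm h"
proof (rule power2_le_imp_le)
  define n where "n = k - CARD('l)"
  have k: "k = CARD('l) + n" "n \<ge> 2" using assms by (auto simp: n_def)
  let ?w = "weight CARD('l)" and ?v = "weight n"
  have "(\<Sum>\<alpha>\<in>F. cmod (coeff h \<alpha>) / sqrt (weight k \<alpha>))\<^sup>2
      = (\<Sum>\<alpha>\<in>F. (1 / sqrt (?v \<alpha>)) * (cmod (coeff h \<alpha>) / sqrt (?w \<alpha>)))\<^sup>2"
    by (simp add: k weight_add_exponent real_sqrt_mult mult.commute)
  also have "\<dots> \<le> (\<Sum>\<alpha>\<in>F. (1 / sqrt (?v \<alpha>))\<^sup>2) * (\<Sum>\<alpha>\<in>F. (cmod (coeff h \<alpha>) / sqrt (?w \<alpha>))\<^sup>2)"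
    by (rule Cauchy_Schwarz_ineq_sum)
  also have "\<dots> = (\<Sum>\<alpha>\<in>F. 1 / ?v \<alpha>) * (\<Sum>\<alpha>\<in>F. (cmod (coeff h \<alpha>))\<^sup>2 / ?w \<alpha>)"
    by (simp add: power_divide)
  also have "\<dots> \<le> 2 * (norm h)\<^sup>2"
    using assms k by (intro mult_mono sum_inverse_weight_le sum_coeff_le_norm sum_nonneg) auto
  finally show "(\<Sum>\<alpha>\<in>F. cmod (coeff h \<alpha>) / sqrt (weight k \<alpha>))\<^sup>2 \<le> (sqrt 2 * norm h)\<^sup>2"
    by (simp add: power_mult_distrib)
qed simp

text \<open>
  After division by the square root of the weight, which is multiplicative in the index, the Wick product is
  an ordinary convolution of an \<open>\<ell>\<^sub>1\<close> family \<open>p\<close> with an \<open>\<ell>\<^sub>2\<close> family \<open>q\<close>. This is Young's inequality for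
  them.
\<close>

lemma sum_wick_conv_le:
  fixes h :: "'l::finite kondratiev" and u :: "'k::finite kondratiev"
  assumes "CARD('k) > CARD('l) + 1" "finite F"
  shows "(\<Sum>\<gamma>\<in>F. (cmod (wick_conv (coeff h) (coeff u) \<gamma>))\<^sup>2 / weight CARD('k) \<gamma>)
    \<le> (2 * norm h * norm u)\<^sup>2"
proof -
  let ?w = "weight CARD('k)"
  define D where "D \<gamma> = {(\<alpha>, \<beta>). \<alpha> + \<beta> = (\<gamma> :: multi_index)}" for \<gamma>
  define p where "p \<alpha> = cmod (coeff h \<alpha>) / sqrt (?w \<alpha>)" for \<alpha>
  define q where "q \<beta> = cmod (coeff u \<beta>) / sqrt (?w \<beta>)" for \<beta>
  define P where "P = sqrt 2 * norm h"
  have finD: "finite (D \<gamma>)" for \<gamma>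
    unfolding D_def by (rule finite_decompositions)
  have p0: "0 \<le> p \<alpha>" for \<alpha> by (simp add: p_def)
  have sum_p: "sum p A \<le> P" if "finite A" for A
    unfolding p_def P_def by (rule sum_sqrt_weight_le[OF assms(1) that])
  have sum_q: "(\<Sum>\<beta>\<in>A. (q \<beta>)\<^sup>2) \<le> (norm u)\<^sup>2" if "finite A" for A
    using sum_coeff_le_norm[OF that, of u] by (simp add: q_def power_divide)
  have young: "(cmod (wick_conv (coeff h) (coeff u) \<gamma>))\<^sup>2 / ?w \<gamma>
      \<le> P * (\<Sum>(\<alpha>, \<beta>)\<in>D \<gamma>. p \<alpha> * (q \<beta>)\<^sup>2)" for \<gamma>
  proof -
    have "cmod (wick_conv (coeff h) (coeff u) \<gamma>) / sqrt (?w \<gamma>)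
        \<le> (\<Sum>(\<alpha>, \<beta>)\<in>D \<gamma>. cmod (coeff h \<alpha> * coeff u \<beta>)) / sqrt (?w \<gamma>)"
      unfolding wick_conv_def D_def[symmetric]
      by (intro divide_right_mono order_trans[OF norm_sum]) (auto intro!: sum_mono)
    also have "\<dots> = (\<Sum>(\<alpha>, \<beta>)\<in>D \<gamma>. p \<alpha> * q \<beta>)"
      unfolding sum_divide_distrib
      by (intro sum.cong)
        (auto simp: D_def p_def q_def weight_add_index real_sqrt_mult norm_mult)
    finally have "(cmod (wick_conv (coeff h) (coeff u) \<gamma>) / sqrt (?w \<gamma>))\<^sup>2
        \<le> (\<Sum>(\<alpha>, \<beta>)\<in>D \<gamma>. p \<alpha> * q \<beta>)\<^sup>2"
      by (intro power_mono) auto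
    \<comment> \<open>Cauchy-Schwarz with the measure \<open>p\<close>: only \<open>q\<close> may appear squared, as \<open>p\<close> is summed in \<open>\<ell>\<^sub>1\<close>.\<close>
    also have "\<dots> = (\<Sum>x\<in>D \<gamma>. sqrt (p (fst x)) * (sqrt (p (fst x)) * q (snd x)))\<^sup>2"
      using p0 by (simp add: case_prod_unfold flip: mult.assoc)
    also have "\<dots> \<le> (\<Sum>x\<in>D \<gamma>. (sqrt (p (fst x)))\<^sup>2) * (\<Sum>x\<in>D \<gamma>. (sqrt (p (fst x)) * q (snd x))\<^sup>2)"
      by (rule Cauchy_Schwarz_ineq_sum)
    also have "\<dots> = (\<Sum>x\<in>D \<gamma>. p (fst x)) * (\<Sum>(\<alpha>, \<beta>)\<in>D \<gamma>. p \<alpha> * (q \<beta>)\<^sup>2)"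
      using p0 by (simp add: case_prod_unfold power_mult_distrib)
    also have "(\<Sum>x\<in>D \<gamma>. p (fst x)) = sum p (fst ` D \<gamma>)"
      by (subst sum.reindex) (auto simp: inj_on_def D_def)
    also have "\<dots> * (\<Sum>(\<alpha>, \<beta>)\<in>D \<gamma>. p \<alpha> * (q \<beta>)\<^sup>2) \<le> P * (\<Sum>(\<alpha>, \<beta>)\<in>D \<gamma>. p \<alpha> * (q \<beta>)\<^sup>2)"
      using finD p0 by (intro mult_right_mono sum_p sum_nonneg) auto
    finally show ?thesis by (simp add: power_divide)
  qed
  define E where "E = (\<Union>\<gamma>\<in>F. D \<gamma>)"
  have finE: "finite E" unfolding E_def using finD assms by auto
  have P0: "0 \<le> P" by (simp add: P_def)
  have "(\<Sum>\<gamma>\<in>F. (cmod (wick_conv (coeff h) (coeff u) \<gamma>))\<^sup>2 / ?w \<gamma>)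
      \<le> (\<Sum>\<gamma>\<in>F. P * (\<Sum>(\<alpha>, \<beta>)\<in>D \<gamma>. p \<alpha> * (q \<beta>)\<^sup>2))"
    by (rule sum_mono) (rule young)
  also have "\<dots> = P * (\<Sum>(\<alpha>, \<beta>)\<in>E. p \<alpha> * (q \<beta>)\<^sup>2)"
    unfolding E_def sum_distrib_left[symmetric]
    by (subst sum.UNION_disjoint) (use finD assms in \<open>auto simp: D_def\<close>)
  also have "\<dots> \<le> P * (\<Sum>(\<alpha>, \<beta>)\<in>fst ` E \<times> snd ` E. p \<alpha> * (q \<beta>)\<^sup>2)"
    using finE p0 P0 by (intro mult_left_mono sum_mono2) (auto intro: rev_image_eqI)
  also have "\<dots> = P * (sum p (fst ` E) * (\<Sum>\<beta>\<in>snd ` E. (q \<beta>)\<^sup>2))"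
    by (simp add: sum_product sum.cartesian_product)
  also have "\<dots> \<le> P * (P * (norm u)\<^sup>2)"
    using finE P0 by (intro mult_left_mono mult_mono sum_p sum_q sum_nonneg) auto
  also have "\<dots> = 2 * ((norm h)\<^sup>2 * (norm u)\<^sup>2)"
    by (simp add: P_def power2_eq_square algebra_simps)
  also have "\<dots> \<le> (2 * norm h * norm u)\<^sup>2"
    by (simp add: power_mult_distrib)
  finally show ?thesis .
qed

lemma coeff_wick:
  fixes h :: "'l::finite kondratiev" and u :: "'k::finite kondratiev"
  assumes "CARD('k) > CARD('l) + 1"
  shows "coeff (h \<lozenge> u) = wick_conv (coeff h) (coeff u)"
  unfolding wick_def
proof (rule Series_inverse, rule CollectI, rule nonneg_bdd_above_summable_on)
  show "bdd_above (sum (\<lambda>\<gamma>. (cmod (wick_conv (coeff h) (coeff u) \<gamma>))\<^sup>2 / weight CARD('k) \<gamma>)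
      ` {F. F \<subseteq> UNIV \<and> finite F})"
    using sum_wick_conv_le[OF assms, of _ h u] by (intro bdd_aboveI2) auto
qed simp

text \<open>
  Vaage's inequality.
\<close>

lemma norm_wick_le:
  fixes h :: "'l::finite kondratiev" and u :: "'k::finite kondratiev"
  assumes "CARD('k) > CARD('l) + 1"
  shows "norm (h \<lozenge> u) \<le> 2 * norm h * norm u"
proof (rule power2_le_imp_le)
  show "(norm (h \<lozenge> u))\<^sup>2 \<le> (2 * norm h * norm u)\<^sup>2"
    unfolding norm_kondratiev_power2 using coeff_summable[of "h \<lozenge> u"]
    by (intro infsum_le_finite_sums)
      (auto simp: coeff_wick[OF assms] intro: sum_wick_conv_le[OF assms])
qed simp

lemma bounded_bilinear_wick:
  assumes "CARD('k::finite) > CARD('l::finite) + 1"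
  shows "bounded_bilinear (wick :: 'l kondratiev \<Rightarrow> 'k kondratiev \<Rightarrow> 'k kondratiev)"
proof
  show "\<exists>K. \<forall>(h :: 'l kondratiev) (u :: 'k kondratiev). norm (h \<lozenge> u) \<le> norm h * norm u * K"
    using norm_wick_le[OF assms] by (intro exI[of _ 2]) (auto simp: ac_simps)
next
  fix h h' :: "'l kondratiev" and u u' :: "'k kondratiev" and r :: real
  show "(h + h') \<lozenge> u = h \<lozenge> u + h' \<lozenge> u"
    by (rule kondratiev_eqI)
      (simp add: coeff_wick[OF assms] wick_conv_def case_prod_unfold distrib_right sum.distrib)
  show "h \<lozenge> (u + u') = h \<lozenge> u + h \<lozenge> u'"
    by (rule kondratiev_eqI)
      (simp add: coeff_wick[OF assms] wick_conv_def case_prod_unfold distrib_left sum.distrib)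
  show "(r *\<^sub>R h) \<lozenge> u = r *\<^sub>R (h \<lozenge> u)"
    by (rule kondratiev_eqI)
      (simp add: coeff_wick[OF assms] wick_conv_def case_prod_unfold sum_distrib_left mult.assoc)
  show "h \<lozenge> (r *\<^sub>R u) = r *\<^sub>R (h \<lozenge> u)"
    by (rule kondratiev_eqI)
      (simp add: coeff_wick[OF assms] wick_conv_def case_prod_unfold sum_distrib_left
        mult.left_commute)
qed


section \<open>Complex linear functionals and the adjoint\<close>

text \<open>
  The type of formal series carries only the structure of a real vector space; this is its multiplication by
  complex scalars.
\<close>

definition cscale :: "complex \<Rightarrow> 'k::finite kondratiev \<Rightarrow> 'k kondratiev" where
  "cscale c f = Series (\<lambda>\<alpha>. c * coeff f \<alpha>)"

lemma coeff_cscale [simp]: "coeff (cscale c f) \<alpha> = c * coeff f \<alpha>"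
  unfolding cscale_def
  by (subst Series_inverse) (auto intro: weighted_summable_scale coeff_summable)

lemma cinner_cscale_left: "cinner (cscale c f) g = c * cinner f g"
  unfolding cinner_def
  by (subst infsum_cmult_right[symmetric]) (auto intro: cinner_summable simp: mult.assoc)

lemma norm_cscale: "norm (cscale c f) = cmod c * norm f"
  unfolding norm_kondratiev_def
  by (simp add: norm_mult power_mult_distrib infsum_cmult_right' real_sqrt_mult
      flip: times_divide_eq_right)

text \<open>
  The real Cauchy-Schwarz inequality suffices after a rotation of \<open>f\<close> that makes the complex inner product
  real and nonnegative.
\<close>

lemma cmod_cinner_le: "cmod (cinner f g) \<le> norm f * norm g"
proof (cases "cinner f g = 0")
  case False
  define c where "c = cnj (cinner f g) / cmod (cinner f g)"
  have c: "cmod c = 1" using False by (simp add: c_def norm_divide)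
  have "complex_of_real (cmod (cinner f g)) = cinner (cscale c f) g"
    using False complex_norm_square[of "cinner f g"]
    by (simp add: c_def cinner_cscale_left divide_simps power2_eq_square mult.commute)
  then have "cmod (cinner f g) = inner (cscale c f) g"
    unfolding inner_kondratiev_def by (metis Re_complex_of_real)
  also have "\<dots> \<le> norm (cscale c f) * norm g"
    by (rule norm_cauchy_schwarz)
  finally show ?thesis by (simp add: norm_cscale c)
qed simp

definition basis_vector :: "multi_index \<Rightarrow> 'k::finite kondratiev" where
  "basis_vector \<alpha> = Series (\<lambda>\<beta>. if \<beta> = \<alpha> then 1 else 0)"

lemma coeff_basis_vector [simp]: "coeff (basis_vector \<alpha> :: 'k::finite kondratiev) \<beta> = (if \<beta> = \<alpha> then 1 else 0)"
proof -
  have "(\<lambda>\<beta>. (cmod (if \<beta> = \<alpha> then 1 else 0))\<^sup>2 / weight CARD('k) \<beta>) summable_on UNIV"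
    by (rule finite_nonzero_values_imp_summable_on) (rule finite_subset[of _ "{\<alpha>}"], auto)
  then show ?thesis
    unfolding basis_vector_def by (subst Series_inverse) auto
qed

lemma coeff_sum [simp]: "coeff (sum f A) \<alpha> = (\<Sum>x\<in>A. coeff (f x) \<alpha>)"
  by (induction A rule: infinite_finite_induct) auto

lemma norm_sum_basis_power2:
  fixes c :: "multi_index \<Rightarrow> complex"
  assumes "finite F"
  shows "(norm (\<Sum>\<alpha>\<in>F. cscale (c \<alpha>) (basis_vector \<alpha>) :: 'k::finite kondratiev))\<^sup>2
    = (\<Sum>\<alpha>\<in>F. (cmod (c \<alpha>))\<^sup>2 / weight CARD('k) \<alpha>)"
proof -
  have *: "coeff (\<Sum>\<alpha>\<in>F. cscale (c \<alpha>) (basis_vector \<alpha>) :: 'k kondratiev) \<beta> = (if \<beta> \<in> F then c \<beta> else 0)" for \<beta>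
    using assms by (simp add: if_distrib[of "\<lambda>x. _ * x"] cong: if_cong)
  have "(norm (\<Sum>\<alpha>\<in>F. cscale (c \<alpha>) (basis_vector \<alpha>) :: 'k kondratiev))\<^sup>2
      = (\<Sum>\<^sub>\<infinity>\<alpha>\<in>F. (cmod (c \<alpha>))\<^sup>2 / weight CARD('k) \<alpha>)"
    unfolding norm_kondratiev_power2 * by (rule infsum_cong_neutral) auto
  then show ?thesis using assms by simp
qed

text \<open>
  The squared distance of \<open>f\<close> from a finite partial sum is the remainder of the series for \<open>\<parallel>f\<parallel>\<^sup>2\<close>.
\<close>

lemma has_sum_basis_expansion:
  fixes f :: "'k::finite kondratiev"
  shows "((\<lambda>\<alpha>. cscale (coeff f \<alpha>) (basis_vector \<alpha>)) has_sum f) UNIV"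
proof -
  let ?t = "\<lambda>\<alpha>. (cmod (coeff f \<alpha>))\<^sup>2 / weight CARD('k) \<alpha>"
  let ?S = "\<lambda>F. \<Sum>\<alpha>\<in>F. cscale (coeff f \<alpha>) (basis_vector \<alpha> :: 'k kondratiev)"
  have "(sum ?t \<longlongrightarrow> (norm f)\<^sup>2) (finite_subsets_at_top UNIV)"
    using has_sum_infsum[OF coeff_summable[of f]]
    by (simp add: has_sum_def norm_kondratiev_power2)
  then have "((\<lambda>F. sqrt ((norm f)\<^sup>2 - sum ?t F)) \<longlongrightarrow> sqrt ((norm f)\<^sup>2 - (norm f)\<^sup>2))
      (finite_subsets_at_top UNIV)"
    by (intro tendsto_intros)
  moreover have "\<forall>\<^sub>F F in finite_subsets_at_top UNIV. sqrt ((norm f)\<^sup>2 - sum ?t F) = norm (?S F - f)"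
  proof (rule eventually_finite_subsets_at_top_weakI)
    show "sqrt ((norm f)\<^sup>2 - sum ?t F) = norm (?S F - f)" if "finite F" for F
    proof -
      have *: "coeff (?S F - f) \<beta> = (if \<beta> \<in> F then 0 else - coeff f \<beta>)" for \<beta>
        using that by (simp add: if_distrib[of "\<lambda>x. _ * x"] cong: if_cong)
      have "(norm (?S F - f))\<^sup>2 = infsum ?t (UNIV - F)"
        unfolding norm_kondratiev_power2 * by (rule infsum_cong_neutral) auto
      also have "\<dots> = infsum ?t UNIV - infsum ?t F"
        using that coeff_summable[of f] by (intro infsum_Diff) auto
      also have "\<dots> = (norm f)\<^sup>2 - sum ?t F"
        using that by (simp add: norm_kondratiev_power2)
      finally show ?thesis by (metis norm_ge_zero real_sqrt_unique)
    qed
  qed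
  ultimately have "((\<lambda>F. norm (?S F - f)) \<longlongrightarrow> sqrt ((norm f)\<^sup>2 - (norm f)\<^sup>2))
      (finite_subsets_at_top UNIV)"
    by (rule Lim_transform_eventually)
  then have "((\<lambda>F. norm (?S F - f)) \<longlongrightarrow> 0) (finite_subsets_at_top UNIV)"
    by simp
  then show ?thesis
    unfolding has_sum_def using Lim_null tendsto_norm_zero_iff by blast
qed

text \<open>
  The equation at \<open>f = H\<^sub>\<alpha>\<close> forces the coefficients \<open>s\<close> of the representing vector. They define an element of
  \<open>\<H>\<^sub>k\<close> because \<open>\<phi>\<close> takes the value \<open>\<parallel>f\<parallel>\<^sup>2\<close> at each truncation \<open>f\<close> of \<open>s\<close>, so that \<open>\<parallel>f\<parallel>\<close> cannot exceed
  the norm of \<open>\<phi>\<close>. The equation extends from the \<open>H\<^sub>\<alpha>\<close> to all \<open>f\<close> by the continuity of \<open>\<phi>\<close>.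
\<close>

lemma riesz_representation:
  fixes \<phi> :: "'k::finite kondratiev \<Rightarrow> complex"
  assumes lin: "bounded_linear \<phi>"
    and homogeneous: "\<And>c f. \<phi> (cscale c f) = c * \<phi> f"
  obtains s where "\<And>f. \<phi> f = cinner f s"
proof -
  interpret bounded_linear \<phi> by (rule lin)
  let ?w = "weight CARD('k)"
  define s where "s \<alpha> = ?w \<alpha> * cnj (\<phi> (basis_vector \<alpha>))" for \<alpha>
  have sum_s: "(\<Sum>\<alpha>\<in>F. (cmod (s \<alpha>))\<^sup>2 / ?w \<alpha>) \<le> (onorm \<phi>)\<^sup>2" if "finite F" for F
  proof -
    let ?f = "\<Sum>\<alpha>\<in>F. cscale (s \<alpha>) (basis_vector \<alpha>) :: 'k kondratiev"
    have "\<phi> ?f = (\<Sum>\<alpha>\<in>F. s \<alpha> * \<phi> (basis_vector \<alpha>))"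
      by (simp add: sum homogeneous)
    also have "\<dots> = (\<Sum>\<alpha>\<in>F. complex_of_real ((cmod (s \<alpha>))\<^sup>2 / ?w \<alpha>))"
      by (intro sum.cong)
        (simp_all only: of_real_divide complex_norm_square, simp_all add: s_def)
    finally have "\<phi> ?f = complex_of_real ((norm ?f)\<^sup>2)"
      by (simp add: norm_sum_basis_power2[OF that])
    then have "(norm ?f)\<^sup>2 \<le> onorm \<phi> * norm ?f"
      using onorm[OF lin, of ?f] by (simp only: norm_of_real abs_power2 zero_le_power2 abs_of_nonneg)
    then have "norm ?f \<le> onorm \<phi>"
      using onorm_pos_le[OF lin]
      by (cases "norm ?f = 0") (auto simp: power2_eq_square)
    then have "(norm ?f)\<^sup>2 \<le> (onorm \<phi>)\<^sup>2" by (intro power_mono) auto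
    then show ?thesis by (simp add: norm_sum_basis_power2[OF that])
  qed
  have s: "coeff (Series s :: 'k kondratiev) = s"
    by (rule Series_inverse, rule CollectI, rule nonneg_bdd_above_summable_on)
      (auto intro!: bdd_aboveI2 sum_s)
  have "\<phi> f = cinner f (Series s)" for f
  proof -
    have "((\<lambda>\<alpha>. \<phi> (cscale (coeff f \<alpha>) (basis_vector \<alpha>))) has_sum \<phi> f) UNIV"
      by (rule has_sum_bounded_linear[OF lin has_sum_basis_expansion])
    then have "((\<lambda>\<alpha>. coeff f \<alpha> * cnj (s \<alpha>) / complex_of_real (?w \<alpha>)) has_sum \<phi> f) UNIV"
      by (simp add: homogeneous s_def)
    then show ?thesis by (simp add: cinner_def s infsumI)
  qed
  then show thesis by (rule that)
qed

text \<open>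
  The Riesz vectors of the functionals \<open>f \<mapsto> \<langle>T f, g\<rangle>\<close> give an adjoint, which is unique; so the definite
  description in \<open>hilbert_adjoint\<close> denotes it.
\<close>

lemma cinner_hilbert_adjoint:
  fixes T :: "'k::finite kondratiev \<Rightarrow> 'k kondratiev"
  assumes T: "bounded_linear T"
    and homogeneous: "\<And>c f. T (cscale c f) = cscale c (T f)"
  shows "cinner (T f) g = cinner f (hilbert_adjoint T g)"
proof -
  have "\<exists>s. \<forall>f. cinner (T f) g = cinner f s" for g
  proof -
    have "bounded_linear (\<lambda>f. cinner f g)"
      by (rule bounded_linear_intro[where K = "norm g"])
        (auto simp: cinner_add_left cinner_scaleR_left scaleR_conv_of_real cmod_cinner_le)
    from bounded_linear_compose[OF this T] obtain s where "\<And>f. cinner (T f) g = cinner f s"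
      by (rule riesz_representation[of "\<lambda>f. cinner (T f) g"]) (auto simp: homogeneous cinner_cscale_left)
    then show ?thesis by blast
  qed
  then obtain S where S: "\<forall>f g. cinner (T f) g = cinner f (S g)" by metis
  have "hilbert_adjoint T = S"
    unfolding hilbert_adjoint_def
  proof (rule the_equality)
    show "\<forall>f g. cinner (T f) g = cinner f (S g)" by (rule S)
  next
    fix S' assume S': "\<forall>f g. cinner (T f) g = cinner f (S' g)"
    have "inner f (S' g) = inner f (S g)" for f g
      using S S' by (simp add: inner_kondratiev_def)
    then have "S' g = S g" for g
      using vector_eq_ldot by blast
    then show "S' = S" by (rule ext)
  qed
  then show ?thesis using S by blast
qed

lemma inner_wick_adjoint:
  fixes h :: "'l::finite kondratiev" and f g :: "'k::finite kondratiev"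
  assumes "CARD('k) > CARD('l) + 1"
  shows "inner (h \<lozenge> f) g = inner f (hilbert_adjoint (wick h) g)"
  unfolding inner_kondratiev_def
proof (rule arg_cong[of _ _ Re], rule cinner_hilbert_adjoint)
  show "bounded_linear (wick h :: 'k kondratiev \<Rightarrow> _)"
    by (rule bounded_bilinear.bounded_linear_right[OF bounded_bilinear_wick[OF assms]])
  show "h \<lozenge> cscale c f = cscale c (h \<lozenge> f)" for c and f :: "'k kondratiev"
    by (rule kondratiev_eqI)
      (simp add: coeff_wick[OF assms] wick_conv_def case_prod_unfold sum_distrib_left
        mult.left_commute)
qed

text \<open>
  Since \<open>T\<^sub>h\<close> is additive in \<open>h\<close>, the difference of the adjoints is the adjoint of \<open>T\<^sub>h\<^sub>-\<^sub>h\<^sub>'\<close>, and Vaage's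
  inequality bounds it.
\<close>

lemma norm_wick_adjoint_diff_le:
  fixes h h' :: "'l::finite kondratiev" and g :: "'k::finite kondratiev"
  assumes "CARD('k) > CARD('l) + 1"
  shows "norm (hilbert_adjoint (wick h) g - hilbert_adjoint (wick h') g)
    \<le> 2 * norm g * norm (h - h')"
proof -
  let ?d = "hilbert_adjoint (wick h) g - hilbert_adjoint (wick h') g"
  have "norm ?d * norm ?d = inner ?d ?d"
    by (simp add: norm_eq_sqrt_inner)
  also have "\<dots> = inner (h \<lozenge> ?d - h' \<lozenge> ?d) g"
    by (simp add: inner_diff_right inner_diff_left inner_wick_adjoint[OF assms])
  also have "h \<lozenge> ?d - h' \<lozenge> ?d = (h - h') \<lozenge> ?d"
    by (rule bounded_bilinear.diff_left[OF bounded_bilinear_wick[OF assms], symmetric])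
  also have "inner \<dots> g \<le> norm ((h - h') \<lozenge> ?d) * norm g"
    by (rule norm_cauchy_schwarz)
  also have "\<dots> \<le> (2 * norm (h - h') * norm ?d) * norm g"
    by (intro mult_right_mono norm_wick_le[OF assms]) simp
  finally have "norm ?d * norm ?d \<le> (2 * norm g * norm (h - h')) * norm ?d"
    by (simp add: mult_ac)
  then show ?thesis
    by (cases "norm ?d = 0") (simp_all only: mult_le_cancel_right_pos zero_less_norm_iff norm_eq_zero,
      simp_all)
qed

lemma continuous_on_wick_adjoint:
  fixes h :: "real \<Rightarrow> 'l::finite kondratiev" and g :: "'k::finite kondratiev"
  assumes "CARD('k) > CARD('l) + 1" "continuous_on A h"
  shows "continuous_on A (\<lambda>t. hilbert_adjoint (wick (h t)) g)"
proof -
  have "(2 * norm g)-lipschitz_on UNIV (\<lambda>h :: 'l kondratiev. hilbert_adjoint (wick h) g)"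
    unfolding lipschitz_on_def dist_norm
    by (intro conjI ballI norm_wick_adjoint_diff_le[OF assms(1)]) simp
  from continuous_on_compose2[OF lipschitz_on_continuous_on[OF this] assms(2)] show ?thesis
    by simp
qed


section \<open>Integrals over compact intervals and over the line\<close>

text \<open>
  Cauchy-Schwarz, from the fact that \<open>\<integral> \<parallel>v - r w\<parallel>\<^sup>2\<close> is a nonnegative quadratic polynomial in \<open>r\<close>.
\<close>

lemma integral_inner_squared_le:
  fixes v w :: "real \<Rightarrow> 'a::real_inner"
  assumes v: "continuous_on {a..b} v" and w: "continuous_on {a..b} w"
  shows "(integral {a..b} (\<lambda>s. inner (v s) (w s)))\<^sup>2
    \<le> integral {a..b} (\<lambda>s. (norm (v s))\<^sup>2) * integral {a..b} (\<lambda>s. (norm (w s))\<^sup>2)"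
proof -
  let ?A = "integral {a..b} (\<lambda>s. (norm (v s))\<^sup>2)" and ?D = "integral {a..b} (\<lambda>s. (norm (w s))\<^sup>2)"
    and ?B = "integral {a..b} (\<lambda>s. inner (v s) (w s))"
  have int: "(\<lambda>s. (norm (v s))\<^sup>2) integrable_on {a..b}" "(\<lambda>s. (norm (w s))\<^sup>2) integrable_on {a..b}"
    "(\<lambda>s. inner (v s) (w s)) integrable_on {a..b}"
    by (intro integrable_continuous_real continuous_intros v w)+
  have quadratic: "0 \<le> ?A - 2 * r * ?B + r\<^sup>2 * ?D" for r
  proof -
    have "((\<lambda>s. (norm (v s))\<^sup>2 - 2 * r * inner (v s) (w s) + r\<^sup>2 * (norm (w s))\<^sup>2)
        has_integral (?A - 2 * r * ?B + r\<^sup>2 * ?D)) {a..b}"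
      by (intro has_integral_add has_integral_diff has_integral_mult_right integrable_integral int)
    moreover have "(norm (v s))\<^sup>2 - 2 * r * inner (v s) (w s) + r\<^sup>2 * (norm (w s))\<^sup>2
        = (norm (v s - r *\<^sub>R w s))\<^sup>2" for s
      unfolding power2_norm_eq_inner
      by (simp add: inner_diff_left inner_diff_right inner_commute[of "w s" "v s"]
          power2_eq_square algebra_simps)
    ultimately show ?thesis
      by (elim has_integral_nonneg) simp
  qed
  have D: "?D \<ge> 0" by (rule integral_nonneg[OF int(2)]) simp
  show ?thesis
  proof (cases "?D = 0")
    case True
    have "?B = 0"
    proof (rule ccontr)
      assume B: "?B \<noteq> 0"
      \<comment> \<open>The polynomial is affine here, and takes the value \<open>-1\<close> at this \<open>r\<close>.\<close>
      then show False using quadratic[of "(?A + 1) / (2 * ?B)"] True by simp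
    qed
    then show ?thesis using True by simp
  next
    case False
    then show ?thesis
      using quadratic[of "?B / ?D"] D by (simp add: field_simps power2_eq_square)
  qed
qed

lemma nn_integral_interval:
  fixes \<phi> :: "real \<Rightarrow> real"
  assumes "continuous_on UNIV \<phi>" "\<And>t. 0 \<le> \<phi> t"
  shows "ennreal (integral {a..b} \<phi>) = (\<integral>\<^sup>+t. ennreal (\<phi> t) * indicator {a..b} t \<partial>lborel)"
  using assms
  by (intro nn_integral_has_integral_lebesgue'[symmetric] integrable_integral
      integrable_continuous_real) (auto intro: continuous_on_subset)

lemma integral_interval_le_nn_integral:
  fixes \<phi> :: "real \<Rightarrow> real"
  assumes "continuous_on UNIV \<phi>" "\<And>t. 0 \<le> \<phi> t"
  shows "ennreal (integral {a..b} \<phi>) \<le> (\<integral>\<^sup>+t. ennreal (\<phi> t) \<partial>lborel)"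
  unfolding nn_integral_interval[OF assms]
  by (intro nn_integral_mono) (auto simp: indicator_def)

text \<open>
  The bridge between the Lebesgue integrals that measure the energies and the integrals over compact intervals
  that define the output.
\<close>

lemma nn_integral_eq_SUP_intervals:
  fixes \<phi> :: "real \<Rightarrow> real"
  assumes "continuous_on UNIV \<phi>" "\<And>t. 0 \<le> \<phi> t"
  shows "(\<integral>\<^sup>+t. ennreal (\<phi> t) \<partial>lborel) = (SUP n. ennreal (integral {-real n..real n} \<phi>))"
proof -
  have [measurable]: "\<phi> \<in> borel_measurable borel"
    by (rule borel_measurable_continuous_onI) fact
  have "(SUP n. ennreal (\<phi> t) * indicator {-real n..real n} t) = ennreal (\<phi> t)" for t
  proof (rule antisym)
    show "(SUP n. ennreal (\<phi> t) * indicator {-real n..real n} t) \<le> ennreal (\<phi> t)"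
      by (rule SUP_least) (auto simp: indicator_def)
    obtain n :: nat where "\<bar>t\<bar> \<le> real n" using real_arch_simple by blast
    then show "ennreal (\<phi> t) \<le> (SUP n. ennreal (\<phi> t) * indicator {-real n..real n} t)"
      by (intro SUP_upper2[of n]) (auto simp: indicator_def)
  qed
  then have "(\<integral>\<^sup>+t. ennreal (\<phi> t) \<partial>lborel)
      = (\<integral>\<^sup>+t. (SUP n. ennreal (\<phi> t) * indicator {-real n..real n} t) \<partial>lborel)"
    by simp
  also have "\<dots> = (SUP n. \<integral>\<^sup>+t. ennreal (\<phi> t) * indicator {-real n..real n} t \<partial>lborel)"
    by (rule nn_integral_monotone_convergence_SUP)
      (auto simp: incseq_def le_fun_def indicator_def)
  finally show ?thesis by (simp only: nn_integral_interval[OF assms])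
qed

lemma integral_symmetric_intervals_tendsto:
  fixes \<phi> :: "real \<Rightarrow> real"
  assumes "continuous_on UNIV \<phi>" "\<And>t. 0 \<le> \<phi> t" "integrable lborel \<phi>"
  shows "(\<lambda>n. integral {-real n..real n} \<phi>) \<longlonglongrightarrow> (LINT t|lborel. \<phi> t)"
proof -
  have mono: "incseq (\<lambda>n. ennreal (integral {-real n..real n} \<phi>))"
    unfolding incseq_def
    by (intro allI impI ennreal_leI integral_subset_le integrable_continuous_real)
      (auto intro: assms continuous_on_subset)
  have "(\<lambda>n. ennreal (integral {-real n..real n} \<phi>)) \<longlonglongrightarrow> ennreal (LINT t|lborel. \<phi> t)"
    using LIMSEQ_SUP[OF mono] assms
    by (simp add: nn_integral_eq_SUP_intervals[OF assms(1,2), symmetric] nn_integral_eq_integral)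
  then show ?thesis
    by (rule tendsto_ennrealD)
      (auto intro!: always_eventually integral_nonneg integral_nonneg_AE integrable_continuous_real
        continuous_on_subset[OF assms(1)] assms)
qed

lemma integral_interval_le_LINT:
  fixes \<phi> :: "real \<Rightarrow> real"
  assumes "continuous_on UNIV \<phi>" "\<And>t. 0 \<le> \<phi> t" "integrable lborel \<phi>"
  shows "integral {a..b} \<phi> \<le> (LINT t|lborel. \<phi> t)"
  using integral_interval_le_nn_integral[OF assms(1,2), of a b] assms
  by (simp add: nn_integral_eq_integral)

lemma lborel_integral_reflect:
  fixes \<phi> :: "real \<Rightarrow> real"
  shows "integrable lborel (\<lambda>s. \<phi> (t - s)) \<longleftrightarrow> integrable lborel \<phi>"
    and "(LINT s|lborel. \<phi> (t - s)) = (LINT s|lborel. \<phi> s)"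
  using lborel_integrable_real_affine_iff[of "-1" \<phi> t] lborel_integral_real_affine[of "-1" \<phi> t]
  by simp_all

lemma has_line_integral_limit:
  assumes "has_line_integral f y"
  shows "(\<lambda>n. integral {-real n..real n} f) \<longlonglongrightarrow> y"
proof -
  have "filterlim (\<lambda>n. (- real n, real n)) (at_bot \<times>\<^sub>F at_top) sequentially"
    by (intro filterlim_Pair filterlim_real_sequentially
        filterlim_compose[OF filterlim_uminus_at_bot_at_top filterlim_real_sequentially])
  from filterlim_compose[OF _ this, of "\<lambda>(a, b). integral {a..b} f" "nhds y"] assms
  show ?thesis by (simp add: has_line_integral_def)
qed

text \<open>
  A Cauchy criterion: the two endpoints tend to \<open>\<plusminus>\<infinity>\<close> independently, but it is enough to compare with the
  symmetric intervals inside. They give the limit, and \<open>r\<close> controls the distance of all larger intervals from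
  it.
\<close>

lemma has_line_integral_Cauchy:
  fixes f :: "real \<Rightarrow> 'a::banach"
  assumes f: "continuous_on UNIV f" and r: "r \<longlonglongrightarrow> 0"
    and tail: "\<And>n a b. a \<le> - real n \<Longrightarrow> real n \<le> b \<Longrightarrow>
      norm (integral {a..b} f - integral {-real n..real n} f) \<le> r n"
  shows "\<exists>y. has_line_integral f y"
proof -
  let ?X = "\<lambda>n. integral {-real n..real n} f"
  have "Cauchy ?X"
  proof (rule metric_CauchyI)
    fix e :: real assume "e > 0"
    then obtain N where N: "r N < e / 2"
      using order_tendstoD(2)[OF r, of "e / 2"] by (auto simp: eventually_sequentially)
    have X: "dist (?X m) (?X N) < e / 2" if "m \<ge> N" for m
      using tail[of "- real m" N "real m"] that N by (simp add: dist_norm)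
    then show "\<exists>N. \<forall>m\<ge>N. \<forall>n\<ge>N. dist (?X m) (?X n) < e"
      by (meson dist_triangle_half_l)
  qed
  then obtain y where y: "?X \<longlonglongrightarrow> y"
    by (auto simp: Cauchy_convergent_iff convergent_def)
  have near: "norm (y - ?X n) \<le> r n" for n
  proof (rule tendsto_upperbound)
    show "(\<lambda>m. norm (?X m - ?X n)) \<longlonglongrightarrow> norm (y - ?X n)"
      by (intro tendsto_intros y)
    show "\<forall>\<^sub>F m in sequentially. norm (?X m - ?X n) \<le> r n"
      by (rule eventually_sequentiallyI[of n]) (simp add: tail)
  qed simp
  have "((\<lambda>(a, b). integral {a..b} f) \<longlongrightarrow> y) (at_bot \<times>\<^sub>F at_top)"
  proof (rule tendstoI)
    fix e :: real assume "e > 0"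
    then obtain n where n: "r n < e / 2"
      using order_tendstoD(2)[OF r, of "e / 2"] by (auto simp: eventually_sequentially)
    have "dist (integral {a..b} f) y < e" if "a \<le> - real n" "real n \<le> b" for a b
    proof -
      have "norm (integral {a..b} f - y)
          = norm ((integral {a..b} f - ?X n) - (y - ?X n))" by simp
      also have "\<dots> \<le> r n + r n"
        by (rule order_trans[OF norm_triangle_ineq4 add_mono[OF tail[OF that] near]])
      finally show ?thesis using n by (simp add: dist_norm)
    qed
    then have "\<forall>\<^sub>F (a, b) in at_bot \<times>\<^sub>F at_top. dist (integral {a..b} f) y < e"
      unfolding eventually_prod_filter
      by (intro exI[of _ "\<lambda>a. a \<le> - real n"] exI[of _ "\<lambda>b. real n \<le> b"])
        (auto intro: eventually_le_at_bot eventually_ge_at_top)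
    then show "\<forall>\<^sub>F p in at_bot \<times>\<^sub>F at_top. dist (case p of (a, b) \<Rightarrow> integral {a..b} f) y < e"
      by (simp add: case_prod_unfold)
  qed
  moreover have "f integrable_on {a..b}" for a b
    by (rule integrable_continuous_real) (rule continuous_on_subset[OF f], simp)
  ultimately show ?thesis unfolding has_line_integral_def by blast
qed


section \<open>Systems on a Hilbert space\<close>

text \<open>
  The duality argument, separated from the Wick product: \<open>T s\<close> stands for \<open>T\<^sub>h\<^sub>(\<^sub>s\<^sub>)\<close> and \<open>S s\<close> for its adjoint.
  The inner product is the real part of the complex one, which gives the same norms. The linearity of both
  families is implied by \<open>adjoint\<close>.
\<close>

locale convolution_system =
  fixes T S :: "real \<Rightarrow> 'a::{real_inner, banach} \<Rightarrow> 'a"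
  assumes adjoint: "inner (T s f) g = inner f (S s g)"
    and continuous_T: "continuous_on UNIV v \<Longrightarrow> continuous_on UNIV (\<lambda>s. T s (v s))"
    and continuous_S: "continuous_on UNIV (\<lambda>s. S s g)"
begin

lemma inner_integral:
  assumes "continuous_on UNIV v"
  shows "inner (integral {a..b} (\<lambda>s. T s (v s))) g = integral {a..b} (\<lambda>s. inner (v s) (S s g))"
proof -
  have "(\<lambda>s. T s (v s)) integrable_on {a..b}"
    by (rule integrable_continuous_real)
      (rule continuous_on_subset[OF continuous_T[OF assms]], simp)
  from integral_linear[OF this bounded_linear_inner_left[of g]] show ?thesis
    by (simp add: o_def adjoint)
qed

text \<open>
  The norm of the integral is its inner product with the unit vector \<open>g\<close> in its own direction, so that
  the energy bound for \<open>g\<close> becomes a bound on the norm.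
\<close>

lemma norm_integral_le:
  assumes C: "C \<ge> 0"
    and energy: "\<And>g. norm g \<le> 1 \<Longrightarrow> (\<integral>\<^sup>+s. ennreal ((norm (S s g))\<^sup>2) \<partial>lborel) \<le> ennreal (C\<^sup>2)"
    and v: "continuous_on UNIV v"
  shows "norm (integral {a..b} (\<lambda>s. T s (v s))) \<le> C * sqrt (integral {a..b} (\<lambda>s. (norm (v s))\<^sup>2))"
proof -
  define y where "y = integral {a..b} (\<lambda>s. T s (v s))"
  define g where "g = sgn y"
  let ?E = "integral {a..b} (\<lambda>s. (norm (S s g))\<^sup>2)"
    and ?U = "integral {a..b} (\<lambda>s. (norm (v s))\<^sup>2)"
  have cont: "continuous_on {a..b} v" "continuous_on {a..b} (\<lambda>s. S s g)"
    using v continuous_S by (auto intro: continuous_on_subset)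
  have U0: "?U \<ge> 0"
    by (intro integral_nonneg integrable_continuous_real continuous_intros cont) simp
  have "ennreal ?E \<le> (\<integral>\<^sup>+s. ennreal ((norm (S s g))\<^sup>2) \<partial>lborel)"
    by (intro integral_interval_le_nn_integral continuous_intros continuous_S) simp
  also have "\<dots> \<le> ennreal (C\<^sup>2)"
    by (rule energy) (simp add: g_def norm_sgn)
  finally have E: "?E \<le> C\<^sup>2" by simp
  have "norm y = inner y g"
    by (cases "y = 0")
      (simp_all add: g_def sgn_div_norm power2_norm_eq_inner[symmetric] power2_eq_square)
  also have "\<dots> = integral {a..b} (\<lambda>s. inner (v s) (S s g))"
    unfolding y_def by (rule inner_integral[OF v])
  finally have "(norm y)\<^sup>2 \<le> ?U * ?E"
    using integral_inner_squared_le[OF cont] by simp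
  also have "\<dots> \<le> ?U * C\<^sup>2"
    using E U0 by (rule mult_left_mono)
  also have "\<dots> = (C * sqrt ?U)\<^sup>2"
    using U0 by (simp add: power_mult_distrib)
  finally show ?thesis
    unfolding y_def by (rule power2_le_imp_le) (use C U0 in simp)
qed

text \<open>
  The bound on compact intervals, applied to the two pieces between a large interval and a symmetric one, makes
  their integrals small with the tails of \<open>\<integral> \<parallel>v\<parallel>\<^sup>2\<close>.
\<close>

lemma bounded_output:
  assumes C: "C \<ge> 0"
    and energy: "\<And>g. norm g \<le> 1 \<Longrightarrow> (\<integral>\<^sup>+s. ennreal ((norm (S s g))\<^sup>2) \<partial>lborel) \<le> ennreal (C\<^sup>2)"
    and v: "continuous_on UNIV v" and L2: "integrable lborel (\<lambda>s. (norm (v s))\<^sup>2)"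
  shows "\<exists>y. has_line_integral (\<lambda>s. T s (v s)) y \<and>
    norm y \<le> C * sqrt (LINT s|lborel. (norm (v s))\<^sup>2)"
proof -
  let ?f = "\<lambda>s. T s (v s)" and ?q = "\<lambda>s. (norm (v s))\<^sup>2"
  let ?U = "LINT s|lborel. ?q s"
  define G where "G a b = integral {a..b} ?q" for a b
  have q: "continuous_on UNIV ?q" by (intro continuous_intros v)
  have int_q: "?q integrable_on {a..b}" for a b
    by (rule integrable_continuous_real) (rule continuous_on_subset[OF q], simp)
  have int_f: "?f integrable_on {a..b}" for a b
    by (rule integrable_continuous_real) (rule continuous_on_subset[OF continuous_T[OF v]], simp)
  have G_le: "G a b \<le> ?U" for a b
    unfolding G_def by (rule integral_interval_le_LINT[OF q _ L2]) simp
  have G0: "0 \<le> G a b" for a b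
    unfolding G_def by (rule integral_nonneg[OF int_q]) simp
  have G_lim: "(\<lambda>n. G (- real n) (real n)) \<longlonglongrightarrow> ?U"
    unfolding G_def by (rule integral_symmetric_intervals_tendsto[OF q _ L2]) simp
  define r where "r n = 2 * C * sqrt (?U - G (- real n) (real n))" for n
  have "r \<longlonglongrightarrow> 2 * C * sqrt (?U - ?U)"
    unfolding r_def by (intro tendsto_intros G_lim)
  then have r: "r \<longlonglongrightarrow> 0" by simp
  have bound: "norm (integral {a..b} ?f) \<le> C * sqrt (G a b)" for a b
    unfolding G_def by (rule norm_integral_le[OF C energy v])
  have tail: "norm (integral {a..b} ?f - integral {-real n..real n} ?f) \<le> r n"
    if "a \<le> - real n" "real n \<le> b" for n a b
  proof -
    have "integral {a..b} ?f = integral {a..-real n} ?f + integral {-real n..real n} ?f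
        + integral {real n..b} ?f"
      using that by (simp add: Henstock_Kurzweil_Integration.integral_combine[OF _ _ int_f])
    then have "norm (integral {a..b} ?f - integral {-real n..real n} ?f)
        = norm (integral {a..-real n} ?f + integral {real n..b} ?f)"
      by simp
    also have "\<dots> \<le> C * sqrt (G a (-real n)) + C * sqrt (G (real n) b)"
      by (rule order_trans[OF norm_triangle_ineq add_mono[OF bound bound]])
    also have "\<dots> \<le> C * sqrt (?U - G (-real n) (real n)) + C * sqrt (?U - G (-real n) (real n))"
    proof -
      have "G a (-real n) + G (-real n) (real n) + G (real n) b = G a b"
        unfolding G_def using that
        by (simp add: Henstock_Kurzweil_Integration.integral_combine[OF _ _ int_q])
      then have "G a (-real n) \<le> ?U - G (-real n) (real n)" "G (real n) b \<le> ?U - G (-real n) (real n)"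
        using G_le[of a b] G0[of a "-real n"] G0[of "real n" b] by linarith+
      then show ?thesis
        using C by (intro add_mono mult_left_mono real_sqrt_le_mono)
    qed
    finally show ?thesis by (simp add: r_def)
  qed
  obtain y where y: "has_line_integral ?f y"
    using has_line_integral_Cauchy[OF continuous_T[OF v] r tail] by blast
  have "norm y \<le> C * sqrt ?U"
  proof (rule Lim_norm_ubound[OF _ has_line_integral_limit[OF y]])
    show "\<forall>\<^sub>F n in sequentially. norm (integral {-real n..real n} ?f) \<le> C * sqrt ?U"
      using C G_le
      by (intro always_eventually allI order_trans[OF bound] mult_left_mono real_sqrt_le_mono)
  qed simp
  with y show ?thesis by blast
qed

text \<open>
  The test input is \<open>S s g\<close>, for which the Cauchy-Schwarz inequality behind \<open>norm_integral_le\<close> is an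
  equality. Since it is not known to be square integrable, it is first multiplied by a cutoff; \<open>0 \<le> cutoff \<le> 1\<close>
  gives \<open>cutoff\<^sup>2 \<le> cutoff\<close>, and so \<open>\<parallel>v\<parallel>\<^sup>2 \<le> \<langle>v, S s g\<rangle>\<close>.
\<close>

lemma energy_le:
  assumes stable: "\<And>v. continuous_on UNIV v \<Longrightarrow> integrable lborel (\<lambda>s. (norm (v s))\<^sup>2) \<Longrightarrow>
      \<exists>y. has_line_integral (\<lambda>s. T s (v s)) y \<and> norm y \<le> M * sqrt (LINT s|lborel. (norm (v s))\<^sup>2)"
    and g: "norm g \<le> 1"
  shows "(\<integral>\<^sup>+s. ennreal ((norm (S s g))\<^sup>2) \<partial>lborel) \<le> ennreal (M\<^sup>2)"
proof -
  let ?e = "\<lambda>s. (norm (S s g))\<^sup>2"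
  have e: "continuous_on UNIV ?e" by (intro continuous_intros continuous_S)
  have int: "q integrable_on {a..b}" if "continuous_on UNIV q" for a b and q :: "real \<Rightarrow> real"
    by (rule integrable_continuous_real) (rule continuous_on_subset[OF that], simp)
  have "integral {-real m..real m} ?e \<le> M\<^sup>2" for m
  proof -
    define cutoff where "cutoff s = max 0 (min 1 (real m + 1 - \<bar>s\<bar>))" for s :: real
    define v where "v s = cutoff s *\<^sub>R S s g" for s
    have cutoff: "continuous_on UNIV cutoff" unfolding cutoff_def by (intro continuous_intros)
    have cutoff01: "0 \<le> cutoff s" "cutoff s \<le> 1" for s by (auto simp: cutoff_def)
    have v: "continuous_on UNIV v" unfolding v_def by (intro continuous_intros cutoff continuous_S)
    have q: "continuous_on UNIV (\<lambda>s. (norm (v s))\<^sup>2)" by (intro continuous_intros v)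
    have "integrable lborel (\<lambda>s. indicator {- real m - 1..real m + 1} s *\<^sub>R (norm (v s))\<^sup>2)"
      by (rule borel_integrable_compact) (auto intro: continuous_on_subset[OF q])
    also have "(\<lambda>s. indicator {- real m - 1..real m + 1} s *\<^sub>R (norm (v s))\<^sup>2)
        = (\<lambda>s. (norm (v s))\<^sup>2)"
      by (auto simp: fun_eq_iff indicator_def v_def cutoff_def)
    finally have L2: "integrable lborel (\<lambda>s. (norm (v s))\<^sup>2)" .
    let ?U = "LINT s|lborel. (norm (v s))\<^sup>2"
    obtain y where y: "has_line_integral (\<lambda>s. T s (v s)) y" "norm y \<le> M * sqrt ?U"
      using stable[OF v L2] by blast
    let ?P = "\<lambda>n. integral {-real n..real n} (\<lambda>s. cutoff s * ?e s)"
    have c: "continuous_on UNIV (\<lambda>s. cutoff s * ?e s)" by (intro continuous_intros cutoff e)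
    have P: "?P n = inner (integral {-real n..real n} (\<lambda>s. T s (v s))) g" for n
      unfolding inner_integral[OF v] by (simp add: v_def power2_norm_eq_inner)
    have lim: "?P \<longlonglongrightarrow> inner y g"
      unfolding P by (intro tendsto_intros has_line_integral_limit y)
    have "?U \<le> inner y g"
    proof (rule LIMSEQ_le[OF integral_symmetric_intervals_tendsto[OF q _ L2] lim])
      have "(norm (v s))\<^sup>2 \<le> cutoff s * ?e s" for s
        using mult_right_mono[OF mult_left_le[OF cutoff01(2)[of s] cutoff01(1)[of s]], of "?e s"]
        using cutoff01[of s] by (simp add: v_def power2_eq_square mult_ac)
      then show "\<exists>N. \<forall>n\<ge>N. integral {-real n..real n} (\<lambda>s. (norm (v s))\<^sup>2) \<le> ?P n"
        by (intro exI allI impI integral_le int q c)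
    qed simp
    moreover have "inner y g \<le> norm y"
      using norm_cauchy_schwarz[of y g] mult_left_mono[OF g, of "norm y"] by simp
    ultimately have J: "?U \<le> inner y g" "inner y g \<le> M * sqrt ?U"
      using y by linarith+
    have U0: "?U \<ge> 0" by simp
    \<comment> \<open>Cancelling \<open>sqrt ?U\<close> in \<open>?U \<le> M * sqrt ?U\<close> bounds it by \<open>M\<close>; a negative \<open>M\<close> forces \<open>?U = 0\<close>.\<close>
    have "inner y g \<le> M\<^sup>2"
    proof (cases "?U = 0")
      case True
      then show ?thesis using J by simp
    next
      case False
      define x where "x = sqrt ?U"
      have "?U > 0" using False U0 by linarith
      then have x: "x > 0" "?U = x * x" by (simp_all add: x_def)
      have "inner y g \<le> M * x" using J by (simp add: x_def)
      then have "x * x \<le> M * x" using J x by linarith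
      then have "x \<le> M" using x(1) by simp
      then have "M * x \<le> M * M" using x(1) by (intro mult_left_mono) auto
      then show ?thesis using \<open>inner y g \<le> M * x\<close> by (simp add: power2_eq_square)
    qed
    moreover have "integral {-real m..real m} ?e \<le> inner y g"
    proof (rule tendsto_lowerbound[OF lim])
      have "integral {-real m..real m} ?e \<le> ?P n" if "n \<ge> m" for n
      proof -
        have "integral {-real m..real m} ?e = ?P m"
          by (rule integral_cong) (auto simp: cutoff_def)
        also have "\<dots> \<le> ?P n"
          using that cutoff01 by (intro integral_subset_le int c) auto
        finally show ?thesis .
      qed
      then show "\<forall>\<^sub>F n in sequentially. integral {-real m..real m} ?e \<le> ?P n"
        by (rule eventually_sequentiallyI)
    qed simp
    ultimately show ?thesis by linarith
  qed
  then show ?thesis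
    by (subst nn_integral_eq_SUP_intervals[OF e]) (auto intro!: SUP_least ennreal_leI)
qed

end


section \<open>The stability criterion\<close>

theorem theorem9p2:
  fixes h :: "real \<Rightarrow> 'l::finite kondratiev"
  assumes "CARD('k::finite) > CARD('l) + 1"
    and "continuous_on UNIV h"
  shows "L2_Linf_stable TYPE('k) h \<longleftrightarrow>
    (SUP g\<in>{g :: 'k kondratiev. norm g \<le> 1}.
      \<integral>\<^sup>+t. ennreal ((norm (hilbert_adjoint (wick (h t)) g))\<^sup>2) \<partial>lborel) < \<infinity>"
    (is "_ \<longleftrightarrow> ?E < \<infinity>")
proof -
  let ?S = "\<lambda>t. hilbert_adjoint (wick (h t)) :: 'k kondratiev \<Rightarrow> 'k kondratiev"
  interpret convolution_system "\<lambda>t. wick (h t)" ?S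
  proof
    show "inner (h s \<lozenge> f) g = inner f (?S s g)" for s and f g :: "'k kondratiev"
      by (rule inner_wick_adjoint[OF assms(1)])
    show "continuous_on UNIV (\<lambda>s. h s \<lozenge> v s)"
      if "continuous_on UNIV v" for v :: "real \<Rightarrow> 'k kondratiev"
      by (rule bounded_bilinear.continuous_on[OF bounded_bilinear_wick[OF assms(1)] assms(2) that])
    show "continuous_on UNIV (\<lambda>s. ?S s g)" for g
      by (rule continuous_on_wick_adjoint[OF assms])
  qed
  show ?thesis
  proof
    assume "L2_Linf_stable TYPE('k) h"
    then obtain M where M: "\<And>u :: real \<Rightarrow> 'k kondratiev.
        continuous_on UNIV u \<Longrightarrow> integrable lborel (\<lambda>t. (norm (u t))\<^sup>2) \<Longrightarrow>
        \<exists>y. (\<forall>t. has_line_integral (\<lambda>s. h s \<lozenge> u (t - s)) (y t)) \<and>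
          (SUP t. ereal (norm (y t))) \<le> ereal (M * sqrt (LINT t|lborel. (norm (u t))\<^sup>2))"
      unfolding L2_Linf_stable_def by blast
    have "\<exists>y. has_line_integral (\<lambda>s. h s \<lozenge> v s) y \<and>
        norm y \<le> M * sqrt (LINT s|lborel. (norm (v s))\<^sup>2)"
      if v: "continuous_on UNIV v" "integrable lborel (\<lambda>s. (norm (v s))\<^sup>2)"
      for v :: "real \<Rightarrow> 'k kondratiev"
    proof -
      \<comment> \<open>At time 0 the reflected input \<open>u t = v (0 - t)\<close> is convolved as \<open>u (0 - s) = v s\<close>.\<close>
      have "continuous_on UNIV (\<lambda>t. v (0 - t))"
        by (rule continuous_on_compose2[OF v(1)]) (auto intro!: continuous_intros)
      moreover have "integrable lborel (\<lambda>t. (norm (v (0 - t)))\<^sup>2)"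
        using v(2) by (subst lborel_integral_reflect(1)[of "\<lambda>s. (norm (v s))\<^sup>2"])
      ultimately obtain y
        where y: "\<And>t. has_line_integral (\<lambda>s. h s \<lozenge> v (0 - (t - s))) (y t)"
          and bound: "(SUP t. ereal (norm (y t)))
            \<le> ereal (M * sqrt (LINT t|lborel. (norm (v (0 - t)))\<^sup>2))"
        using M[of "\<lambda>t. v (0 - t)"] by blast
      have "ereal (norm (y 0)) \<le> (SUP t. ereal (norm (y t)))"
        by (rule SUP_upper) simp
      also note bound
      also have "(LINT t|lborel. (norm (v (0 - t)))\<^sup>2) = (LINT s|lborel. (norm (v s))\<^sup>2)"
        by (rule lborel_integral_reflect(2)[of "\<lambda>s. (norm (v s))\<^sup>2"])
      finally have "norm (y 0) \<le> M * sqrt (LINT s|lborel. (norm (v s))\<^sup>2)" by simp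
      then show ?thesis using y[of 0] by auto
    qed
    then have "?E \<le> ennreal (M\<^sup>2)"
      by (intro SUP_least energy_le) simp_all
    also have "\<dots> < \<infinity>" by simp
    finally show "?E < \<infinity>" .
  next
    assume E: "?E < \<infinity>"
    define C where "C = sqrt (enn2real ?E)"
    have C0: "C \<ge> 0" by (simp add: C_def)
    have C: "ennreal (C\<^sup>2) = ?E"
      using E by (simp add: C_def)
    have energy: "(\<integral>\<^sup>+s. ennreal ((norm (?S s g))\<^sup>2) \<partial>lborel) \<le> ennreal (C\<^sup>2)"
      if "norm g \<le> 1" for g
      unfolding C by (rule SUP_upper) (use that in simp)
    show "L2_Linf_stable TYPE('k) h"
      unfolding L2_Linf_stable_def
    proof (intro exI[of _ C] allI impI)
      fix u :: "real \<Rightarrow> 'k kondratiev"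
      assume u: "continuous_on UNIV u" "integrable lborel (\<lambda>t. (norm (u t))\<^sup>2)"
      have "\<exists>y. has_line_integral (\<lambda>s. h s \<lozenge> u (t - s)) y \<and>
          norm y \<le> C * sqrt (LINT s|lborel. (norm (u s))\<^sup>2)" for t
      proof -
        have "continuous_on UNIV (\<lambda>s. u (t - s))"
          by (rule continuous_on_compose2[OF u(1)]) (auto intro!: continuous_intros)
        from bounded_output[OF C0 energy this] u(2) show ?thesis
          by (simp add: lborel_integral_reflect[of "\<lambda>s. (norm (u s))\<^sup>2"])
      qed
      then obtain y where y: "\<And>t. has_line_integral (\<lambda>s. h s \<lozenge> u (t - s)) (y t)"
        "\<And>t. norm (y t) \<le> C * sqrt (LINT s|lborel. (norm (u s))\<^sup>2)"
        by metis
      then show "\<exists>y. (\<forall>t. has_line_integral (\<lambda>s. h s \<lozenge> u (t - s)) (y t)) \<and>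
          (SUP t. ereal (norm (y t))) \<le> ereal (C * sqrt (LINT t|lborel. (norm (u t))\<^sup>2))"
        by (intro exI[of _ y] conjI allI SUP_least) auto
    qed
  qed
qed

end
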